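(* For every graphon $K$, we have $\sigma(K)\le \frac{8}{7}$.
   Context: A graphon is a symmetric Lebesgue measurable function $K:[0,1]^2\to[0,1]$. It defines the compact self-adjoint operator $A_K$ on the real Hilbert space $L^2[0,1]$ by $(A_Kh)(x)=\int_0^1K(x,y)h(y)\,dy$. The largest and second largest eigenvalues of $A_K$ (with multiplicity) are \[ \mu_1(K)=\sup_{\|h\|_2=1}\langle h,A_Kh\rangle,\qquad \mu_2(K)=\sup_{\substack{U\subset L^2[0,1]\\ \dim U=2}}\ \min_{\substack{h\in U\\ \|h\|_2=1}}\langle h,A_Kh\rangle , \] and $\sigma(K)=\mu_1(K)+\mu_2(K)$ is the spectral sum of $K$. (These quantities depend only on the class of $K$ modulo cut distance zero.) *)

theory Defs
  imports "HOL-Analysis.Analysis"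
begin

subsection \<open>The real Hilbert space \<open>L\<^sup>2[0,1]\<close>\<close>

abbreviation leb01 :: "real measure" where
  "leb01 \<equiv> lebesgue_on {0..1}"

definition square_integrable :: "(real \<Rightarrow> real) \<Rightarrow> bool" where
  "square_integrable f \<longleftrightarrow> f \<in> borel_measurable leb01 \<and> integrable leb01 (\<lambda>x. (f x)\<^sup>2)"

definition L2_eq :: "(real \<Rightarrow> real) \<Rightarrow> (real \<Rightarrow> real) \<Rightarrow> bool" where
  "L2_eq f g \<longleftrightarrow> square_integrable f \<and> square_integrable g \<and> (AE x in leb01. f x = g x)"

lemma part_equivp_L2_eq: "part_equivp L2_eq"
proof (rule part_equivpI)
  show "\<exists>f. L2_eq f f"
    by (rule exI[of _ "\<lambda>_. 0"]) (simp add: L2_eq_def square_integrable_def)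
  show "symp L2_eq"
    by (rule sympI) (auto simp: L2_eq_def elim: AE_mp)
  show "transp L2_eq"
    by (rule transpI) (auto simp: L2_eq_def elim: AE_mp)
qed

text \<open>
  Elements are the classes, modulo equality almost everywhere, of the square-integrable Lebesgue
  measurable functions on \<open>[0,1]\<close>; values of a representative outside \<open>[0,1]\<close> are irrelevant.
\<close>

quotient_type L2 = "real \<Rightarrow> real" / partial: L2_eq
  by (rule part_equivp_L2_eq)

lemma L2_eq_refl: "L2_eq f f \<longleftrightarrow> square_integrable f"
  by (simp add: L2_eq_def)

lemma square_integrable_mult:
  assumes "square_integrable f" "square_integrable g"
  shows "integrable leb01 (\<lambda>x. f x * g x)"
proof (rule Bochner_Integration.integrable_bound)
  show "integrable leb01 (\<lambda>x. (f x)\<^sup>2 + (g x)\<^sup>2)"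
    using assms by (simp add: square_integrable_def)
  show "(\<lambda>x. f x * g x) \<in> borel_measurable leb01"
    using assms by (auto simp: square_integrable_def intro: borel_measurable_times)
  have "\<bar>a * b\<bar> \<le> \<bar>a\<^sup>2 + b\<^sup>2\<bar>" for a b :: real
  proof -
    have "2 * (\<bar>a\<bar> * \<bar>b\<bar>) \<le> \<bar>a\<bar>\<^sup>2 + \<bar>b\<bar>\<^sup>2"
      using sum_squares_bound[of "\<bar>a\<bar>" "\<bar>b\<bar>"] by (simp add: mult.assoc)
    moreover have "0 \<le> \<bar>a\<bar> * \<bar>b\<bar>"
      by simp
    ultimately have "\<bar>a\<bar> * \<bar>b\<bar> \<le> a\<^sup>2 + b\<^sup>2"
      unfolding power2_abs by linarith
    then show ?thesis
      by (simp add: abs_mult)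
  qed
  then show "AE x in leb01. norm (f x * g x) \<le> norm ((f x)\<^sup>2 + (g x)\<^sup>2)"
    by simp
qed

lemma square_integrable_add:
  assumes "square_integrable f" "square_integrable g"
  shows "square_integrable (\<lambda>x. f x + g x)"
proof -
  have "integrable leb01 (\<lambda>x. (f x)\<^sup>2 + (g x)\<^sup>2 + 2 * (f x * g x))"
    using assms square_integrable_mult[OF assms] by (simp add: square_integrable_def)
  also have "(\<lambda>x. (f x)\<^sup>2 + (g x)\<^sup>2 + 2 * (f x * g x)) = (\<lambda>x. (f x + g x)\<^sup>2)"
    by (auto simp: power2_eq_square algebra_simps)
  finally show ?thesis
    using assms by (auto simp: square_integrable_def intro: borel_measurable_add)
qed

lemma square_integrable_scale: "square_integrable f \<Longrightarrow> square_integrable (\<lambda>x. c * f x)"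
  by (auto simp: square_integrable_def power_mult_distrib intro: borel_measurable_times)

lemma square_integrable_zero: "square_integrable (\<lambda>x. 0)"
  by (simp add: square_integrable_def)

lemma square_integrable_uminus: "square_integrable f \<Longrightarrow> square_integrable (\<lambda>x. - f x)"
  by (simp add: square_integrable_def)

instantiation L2 :: real_vector
begin

lift_definition zero_L2 :: L2 is "\<lambda>x. 0"
  by (simp add: L2_eq_refl square_integrable_zero)

lift_definition plus_L2 :: "L2 \<Rightarrow> L2 \<Rightarrow> L2" is "\<lambda>f g x. f x + g x"
  by (auto simp: L2_eq_def square_integrable_add elim: AE_mp)

lift_definition uminus_L2 :: "L2 \<Rightarrow> L2" is "\<lambda>f x. - f x"
  by (auto simp: L2_eq_def square_integrable_uminus)

lift_definition scaleR_L2 :: "real \<Rightarrow> L2 \<Rightarrow> L2" is "\<lambda>c f x. c * f x"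
  by (auto simp: L2_eq_def square_integrable_scale elim: AE_mp)

definition minus_L2 :: "L2 \<Rightarrow> L2 \<Rightarrow> L2" where
  "minus_L2 f g = f + (- g)"

instance
proof
  fix f g h :: L2 and c d :: real
  show "f + g + h = f + (g + h)"
    by transfer (auto simp: L2_eq_def add.assoc intro!: square_integrable_add)
  show "f + g = g + f"
    by transfer (auto simp: L2_eq_def add.commute intro!: square_integrable_add)
  show "0 + f = f"
    by transfer (auto simp: L2_eq_def)
  show "- f + f = 0"
    by transfer (auto simp: L2_eq_def square_integrable_zero)
  show "f - g = f + - g"
    by (rule minus_L2_def)
  show "c *\<^sub>R (f + g) = c *\<^sub>R f + c *\<^sub>R g"
    by transfer (auto simp: L2_eq_def distrib_left
        intro!: square_integrable_add square_integrable_scale)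
  show "(c + d) *\<^sub>R f = c *\<^sub>R f + d *\<^sub>R f"
    by transfer (auto simp: L2_eq_def distrib_right
        intro!: square_integrable_add square_integrable_scale)
  show "c *\<^sub>R d *\<^sub>R f = (c * d) *\<^sub>R f"
    by transfer (auto simp: L2_eq_def mult.assoc intro!: square_integrable_scale)
  show "1 *\<^sub>R f = f"
    by transfer (auto simp: L2_eq_def)
qed

end

instantiation L2 :: real_inner
begin

lift_definition inner_L2 :: "L2 \<Rightarrow> L2 \<Rightarrow> real" is "\<lambda>f g. LINT x|leb01. f x * g x"
proof -
  fix f f' g g' :: "real \<Rightarrow> real"
  assume "L2_eq f f'" "L2_eq g g'"
  then show "(LINT x|leb01. f x * g x) = (LINT x|leb01. f' x * g' x)"
    by (intro integral_cong_AE) (auto simp: L2_eq_def square_integrable_def elim: AE_mp)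
qed

definition norm_L2 :: "L2 \<Rightarrow> real" where
  "norm_L2 f = sqrt (inner f f)"

definition dist_L2 :: "L2 \<Rightarrow> L2 \<Rightarrow> real" where
  "dist_L2 f g = norm (f - g)"

definition sgn_L2 :: "L2 \<Rightarrow> L2" where
  "sgn_L2 f = f /\<^sub>R norm f"

definition uniformity_L2 :: "(L2 \<times> L2) filter" where
  "uniformity_L2 = (INF e\<in>{0<..}. principal {(f, g). dist f g < e})"

definition open_L2 :: "L2 set \<Rightarrow> bool" where
  "open_L2 U \<longleftrightarrow> (\<forall>f\<in>U. \<forall>\<^sub>F (f', g) in uniformity. f' = f \<longrightarrow> g \<in> U)"

instance
proof
  fix f g h :: L2 and c :: real
  show "dist f g = norm (f - g)"
    by (rule dist_L2_def)
  show "sgn f = f /\<^sub>R norm f"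
    by (rule sgn_L2_def)
  show "(uniformity :: (L2 \<times> L2) filter) = (INF e\<in>{0<..}. principal {(f, g). dist f g < e})"
    by (rule uniformity_L2_def)
  show "open U \<longleftrightarrow> (\<forall>f\<in>U. \<forall>\<^sub>F (f', g) in uniformity. f' = f \<longrightarrow> g \<in> U)" for U :: "L2 set"
    by (rule open_L2_def)
  show "norm f = sqrt (inner f f)"
    by (rule norm_L2_def)
  show "inner f g = inner g f"
    by transfer (simp add: mult.commute)
  show "inner (f + g) h = inner f h + inner g h"
    by transfer (simp add: distrib_right square_integrable_mult L2_eq_refl)
  show "inner (c *\<^sub>R f) g = c * inner f g"
    by transfer (simp add: mult.assoc)
  show "0 \<le> inner f f"
    by transfer simp
  show "inner f f = 0 \<longleftrightarrow> f = 0"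
  proof transfer
    fix f :: "real \<Rightarrow> real"
    assume "L2_eq f f"
    then have f: "square_integrable f"
      by (simp add: L2_eq_refl)
    then have "(LINT x|leb01. f x * f x) = 0 \<longleftrightarrow> (AE x in leb01. f x * f x = 0)"
      by (intro integral_nonneg_eq_0_iff_AE) (auto simp: square_integrable_mult)
    with f show "(LINT x|leb01. f x * f x) = 0 \<longleftrightarrow> L2_eq f (\<lambda>x. 0)"
      by (simp add: L2_eq_def square_integrable_zero)
  qed
qed

end

subsection \<open>Graphons and their operators\<close>

definition graphon :: "(real \<times> real \<Rightarrow> real) \<Rightarrow> bool" where
  "graphon K \<longleftrightarrow>
     K \<in> borel_measurable (lebesgue_on ({0..1} \<times> {0..1})) \<and>
     (\<forall>x\<in>{0..1}. \<forall>y\<in>{0..1}. K (x, y) \<in> {0..1} \<and> K (x, y) = K (y, x))"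

definition kernel_integral :: "(real \<times> real \<Rightarrow> real) \<Rightarrow> (real \<Rightarrow> real) \<Rightarrow> real \<Rightarrow> real" where
  "kernel_integral K h x = (LINT y|leb01. K (x, y) * h y)"

text \<open>
  The operator \<open>A\<^sub>K\<close>. \<^const>\<open>abs_L2\<close> is only meaningful on square-integrable functions;
  the lemmas below show that this is the case when \<open>K\<close> is a graphon, and that
  the representative \<^term>\<open>rep_L2 h\<close> may be replaced by any other one. (For Lebesgue measurable
  \<open>K\<close> only almost all sections need be measurable; elsewhere the integral has a junk value.)
\<close>

definition graphon_op :: "(real \<times> real \<Rightarrow> real) \<Rightarrow> L2 \<Rightarrow> L2" where
  "graphon_op K h = abs_L2 (kernel_integral K (rep_L2 h))"

lemma integrable_const_leb01: "integrable leb01 (\<lambda>x. c :: real)"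
  by (intro finite_measure.integrable_const finite_measure_lebesgue_on) simp

lemma borel_measurable_leb01_iff:
  fixes g :: "real \<Rightarrow> real"
  shows "g \<in> borel_measurable leb01 \<longleftrightarrow> (\<lambda>x. indicator {0..1} x * g x) \<in> borel_measurable lebesgue"
  using borel_measurable_restrict_space_iff[of "{0..1}" lebesgue g] by simp

lemma borel_measurable_leb01_AE:
  fixes f g :: "real \<Rightarrow> real"
  assumes f: "f \<in> borel_measurable leb01" and ae: "AE x in leb01. f x = g x"
  shows "g \<in> borel_measurable leb01"
proof -
  have "AE x in lebesgue. indicator {0..1} x * f x = indicator {0..1} x * g x"
    using ae by (auto simp: AE_restrict_space_iff indicator_def elim: AE_mp)
  with f show ?thesis
    unfolding borel_measurable_leb01_iff by (rule borel_measurable_AE)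
qed

lemma leb01_integral_cong_AE:
  fixes f g :: "real \<Rightarrow> real"
  assumes ae: "AE x in leb01. f x = g x"
  shows "(LINT x|leb01. f x) = (LINT x|leb01. g x)"
proof (cases "f \<in> borel_measurable leb01")
  case True
  with ae show ?thesis
    using integral_cong_AE[OF True borel_measurable_leb01_AE[OF True ae] ae] by simp
next
  case False
  have "AE x in leb01. g x = f x"
    using ae by eventually_elim simp
  with False have "g \<notin> borel_measurable leb01"
    using borel_measurable_leb01_AE by blast
  with False show ?thesis
    by (metis borel_measurable_integrable not_integrable_integral_eq)
qed

lemma square_integrable_imp_integrable:
  assumes "square_integrable h"
  shows "integrable leb01 h"
proof -
  have "square_integrable (\<lambda>x. 1)"
    by (simp add: square_integrable_def integrable_const_leb01)
  from square_integrable_mult[OF assms this] show ?thesis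
    by simp
qed

lemma leb01_integral:
  fixes g :: "real \<Rightarrow> real"
  shows "(LINT y|leb01. g y) = (LINT y|lebesgue. indicator {0..1} y * g y)"
  by (subst integral_restrict_space) auto

lemma square_integrable_kernel_integral:
  assumes K: "graphon K" and h: "square_integrable h"
  shows "square_integrable (kernel_integral K h)"
proof -
  define S :: "(real \<times> real) set" where "S = {0..1} \<times> {0..1}"
  have S: "S \<in> sets lebesgue"
    unfolding S_def by (intro sets_completionI_sets) (simp add: borel_Times)
  define K0 where "K0 p = indicator S p * K p" for p
  define h0 where "h0 y = indicator {0..1} y * h y" for y :: real
  have K0_bound: "0 \<le> K0 p \<and> K0 p \<le> 1" for p
    using K by (cases p) (auto simp: K0_def S_def graphon_def indicator_def)
  have "K0 \<in> borel_measurable lebesgue"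
    using K S borel_measurable_restrict_space_iff[of S lebesgue K]
    by (simp add: graphon_def K0_def[abs_def] S_def)
  then have "K0 \<in> borel_measurable (completion lborel)" .
  from completion_ex_borel_measurable_real[OF this]
  obtain K1 where K1: "K1 \<in> borel_measurable lborel" and K1_eq: "AE p in lborel. K0 p = K1 p"
    by blast
  have hm: "h0 \<in> borel_measurable lebesgue"
    using h borel_measurable_restrict_space_iff[of "{0..1}" lebesgue h]
    by (simp add: square_integrable_def h0_def[abs_def])
  from completion_ex_borel_measurable_real[OF this]
  obtain h1 where h1: "h1 \<in> borel_measurable lborel" and h1_eq: "AE y in lborel. h0 y = h1 y"
    by blast
  have h_int: "integrable leb01 h"
    by (rule square_integrable_imp_integrable[OF h])
  have "AE p in lborel \<Otimes>\<^sub>M lborel. K0 p = K1 p"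
    using K1_eq unfolding lborel_prod .
  from lborel_pair.AE_pair[OF this] have sect: "AE x in lborel. AE y in lborel. K0 (x, y) = K1 (x, y)"
    by simp
  define F where "F x = (LINT y|lborel. K1 (x, y) * h1 y)" for x
  have F_meas: "F \<in> borel_measurable lborel"
  proof -
    have "K1 \<in> borel_measurable (lborel \<Otimes>\<^sub>M lborel)"
      using K1 by (simp add: lborel_prod)
    then have "(\<lambda>(x, y). K1 (x, y) * h1 y) \<in> borel_measurable (lborel \<Otimes>\<^sub>M lborel)"
      using h1 by measurable
    then show ?thesis
      unfolding F_def by (rule lborel.borel_measurable_lebesgue_integral)
  qed
  have eq: "kernel_integral K h x = F x \<and> \<bar>kernel_integral K h x\<bar> \<le> (LINT y|leb01. \<bar>h y\<bar>)"
    if x: "x \<in> {0..1}" and ae: "AE y in lborel. K0 (x, y) = K1 (x, y)" for x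
  proof -
    have ki: "kernel_integral K h x = (LINT y|lebesgue. K0 (x, y) * h0 y)"
      unfolding kernel_integral_def leb01_integral
      using x by (intro Bochner_Integration.integral_cong)
        (auto simp: K0_def h0_def S_def indicator_def)
    have K1x: "(\<lambda>y. K1 (x, y)) \<in> borel_measurable lborel"
      using K1 by measurable
    have K1x': "(\<lambda>y. K1 (x, y)) \<in> borel_measurable lebesgue"
      by (rule measurable_completion[OF K1x])
    have K0x: "(\<lambda>y. K0 (x, y)) \<in> borel_measurable lebesgue"
    proof -
      have "AE y in lebesgue. K1 (x, y) = K0 (x, y)"
        using AE_completion[OF ae] by eventually_elim simp
      with K1x' show ?thesis
        by (rule borel_measurable_AE)
    qed
    have "(LINT y|lebesgue. K0 (x, y) * h0 y) = (LINT y|lebesgue. K1 (x, y) * h1 y)"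
    proof (rule integral_cong_AE)
      show "AE y in lebesgue. K0 (x, y) * h0 y = K1 (x, y) * h1 y"
        using AE_completion[OF ae] AE_completion[OF h1_eq] by eventually_elim simp
    qed (use K0x K1x' hm measurable_completion[OF h1] in measurable)
    also have "\<dots> = F x"
      unfolding F_def by (rule integral_completion) (use K1x h1 in measurable)
    finally have "kernel_integral K h x = F x"
      using ki by simp
    moreover have "\<bar>kernel_integral K h x\<bar> \<le> (LINT y|leb01. \<bar>h y\<bar>)"
    proof -
      have "\<bar>kernel_integral K h x\<bar> \<le> (LINT y|leb01. \<bar>K (x, y) * h y\<bar>)"
        unfolding kernel_integral_def by (rule integral_abs_bound)
      also have "\<dots> \<le> (LINT y|leb01. \<bar>h y\<bar>)"
      proof (rule integral_mono_AE')
        show "integrable leb01 (\<lambda>y. \<bar>h y\<bar>)"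
          using h_int by simp
        show "AE y in leb01. \<bar>K (x, y) * h y\<bar> \<le> \<bar>h y\<bar>"
          using x K by (intro AE_I2) (auto simp: graphon_def abs_mult intro!: mult_left_le_one_le)
        show "AE y in leb01. 0 \<le> \<bar>h y\<bar>"
          by simp
      qed
      finally show ?thesis .
    qed
    ultimately show ?thesis
      by blast
  qed
  have ae01: "AE x in leb01. kernel_integral K h x = F x \<and>
      \<bar>kernel_integral K h x\<bar> \<le> (LINT y|leb01. \<bar>h y\<bar>)"
  proof -
    have "AE x in lebesgue. x \<in> {0..1} \<longrightarrow> kernel_integral K h x = F x \<and>
        \<bar>kernel_integral K h x\<bar> \<le> (LINT y|leb01. \<bar>h y\<bar>)"
      using AE_completion[OF sect] by eventually_elim (use eq in blast)
    then show ?thesis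
      by (subst AE_restrict_space_iff) auto
  qed
  have meas: "kernel_integral K h \<in> borel_measurable leb01"
  proof -
    have "F \<in> borel_measurable leb01"
      using measurable_completion[OF F_meas] by (rule measurable_restrict_space1)
    moreover have "AE x in leb01. F x = kernel_integral K h x"
      using ae01 by eventually_elim simp
    ultimately show ?thesis
      by (rule borel_measurable_leb01_AE)
  qed
  moreover have "integrable leb01 (\<lambda>x. (kernel_integral K h x)\<^sup>2)"
  proof (rule Bochner_Integration.integrable_bound)
    show "integrable leb01 (\<lambda>x. (LINT y|leb01. \<bar>h y\<bar>)\<^sup>2)"
      by (rule integrable_const_leb01)
    show "AE x in leb01. norm ((kernel_integral K h x)\<^sup>2) \<le> norm ((LINT y|leb01. \<bar>h y\<bar>)\<^sup>2)"
      using ae01 by eventually_elim (auto simp: abs_le_square_iff[symmetric])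
  qed (use meas in measurable)
  ultimately show ?thesis
    by (simp add: square_integrable_def)
qed

lemma graphon_op_abs:
  assumes h: "square_integrable h"
  shows "graphon_op K (abs_L2 h) = abs_L2 (kernel_integral K h)"
proof -
  have "L2_eq h (rep_L2 (abs_L2 h))"
    using h by (metis L2_eq_refl Quotient3_L2 rep_abs_rsp)
  then have ae: "AE y in leb01. rep_L2 (abs_L2 h) y = h y"
    by (auto simp: L2_eq_def elim: AE_mp)
  have "kernel_integral K (rep_L2 (abs_L2 h)) x = kernel_integral K h x" for x
    unfolding kernel_integral_def
    by (rule leb01_integral_cong_AE) (use ae in eventually_elim, simp)
  then have "kernel_integral K (rep_L2 (abs_L2 h)) = kernel_integral K h"
    by (rule ext)
  then show ?thesis
    by (simp add: graphon_op_def)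
qed

text \<open>
  In \<open>\<mu>\<^sub>2\<close> the minimum over the unit sphere of \<open>U\<close> is written as an infimum; it is attained,
  that sphere being compact.
\<close>

definition mu1 :: "(real \<times> real \<Rightarrow> real) \<Rightarrow> real" where
  "mu1 K = (SUP h\<in>{h. norm h = 1}. inner h (graphon_op K h))"

definition mu2 :: "(real \<times> real \<Rightarrow> real) \<Rightarrow> real" where
  "mu2 K = (SUP U\<in>{U. subspace U \<and> dim U = 2}. INF h\<in>{h \<in> U. norm h = 1}. inner h (graphon_op K h))"

definition spectral_sum :: "(real \<times> real \<Rightarrow> real) \<Rightarrow> real" where
  "spectral_sum K = mu1 K + mu2 K"

end

theory Submission
  imports Defs
begin

text \<open>
  By Ky Fan's principle, the sum of the two largest eigenvalues of a symmetric operator \<open>A\<close> is the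
  supremum of \<open>inner f (A f) + inner g (A g)\<close> over orthonormal pairs. So the claim is that
  \<open>\<integral>\<integral> K(x,y) (f(x) f(y) + g(x) g(y)) \<le> 8/7\<close> for every orthonormal pair (\<open>orthonormal_pair_bound\<close>).
  For fixed step functions \<open>f\<close> and \<open>g\<close> the worst \<open>K\<close> is the indicator of the set where the bracket is
  nonnegative, and what remains is a statement about a finite set with weights
  (\<open>finite_pair_bound\<close>); step functions are dense and the operator is bounded, so this is enough.

  On a finite set there are only finitely many graphs, and one can choose a graph \<open>K\<close> for which the sum
  \<open>l + k\<close> of the two largest eigenvalues is maximal, and which among these has an inclusion-maximal
  set of edges. Let \<open>f \<ge> 0\<close> and \<open>g\<close> be its eigenvectors. By this choice of \<open>K\<close>, two points
  are adjacent exactly if \<open>f f' + g g' \<ge> 0\<close>, so non-adjacent points have values of \<open>g\<close> of opposite signs: the complement \<open>N\<close> of \<open>K\<close> is bipartite between \<open>g > 0\<close> and \<open>g < 0\<close>.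

  Now normalise \<open>\<integral> f = 1\<close> and \<open>\<integral> \<bar>g\<bar> = 1\<close>, and suppose first that \<open>\<integral> g = 0\<close>. Then \<open>q = N f = 1 - l f\<close> is
  nonnegative with integral \<open>1 - l\<close>, and \<open>N \<bar>g\<bar> = k \<bar>g\<bar>\<close>. Moving \<open>N\<close> from one factor to the other in
  \<open>\<integral> q (N \<bar>g\<bar>)\<close> gives \<open>(l + k) \<integral> q \<bar>g\<bar> = k\<close>, while \<open>k \<bar>g\<bar> \<le> 1/2\<close> pointwise because \<open>N \<bar>g\<bar>\<close> is at
  most the integral of \<open>\<bar>g\<bar>\<close> over the opposite side. Hence \<open>1 - l \<ge> 2 k\<^sup>2 / (l + k)\<close>, and with
  \<open>s = l + k\<close> this reads \<open>(4 k - s)\<^sup>2 + s (7 s - 8) \<le> 0\<close>, so \<open>s \<le> 8/7\<close>. Equality holds for blocks of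
  measures \<open>2/7, 3/7, 2/7\<close> whose two outer blocks are not adjacent, with \<open>l = 6/7\<close> and \<open>k = 2/7\<close>.

  If \<open>T = \<integral> g\<close> is not zero, the same computation leaves an error term \<open>T (l - k) D\<close>, where \<open>D\<close> is the
  difference of the integrals of \<open>q\<close> over \<open>g \<ge> 0\<close> and \<open>g < 0\<close>. A second identity of the same kind,
  combined with the bound \<open>\<integral>\<integral> N \<ge> 2 k\<^sup>2\<close> (\<open>nonedge_density\<close>) and a bound for \<open>T\<close>, shows that \<open>D\<close> cannot
  have the sign that would allow \<open>l + k > 8/7\<close> (\<open>eigenvalue_sum_bound_normalized\<close>, \<open>spectral_sum_arithmetic\<close>).
\<close>

section \<open>An inequality between real numbers\<close>

text \<open>
  This is the end of the argument for a single extremal configuration; the variables are the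
  integrals introduced in \<open>eigenvalue_sum_bound_normalized\<close>. Put \<open>s = l + k\<close>. Then
  \<open>8 (2 k\<^sup>2 - (1 - l) s) = (4 k - s)\<^sup>2 + s (7 s - 8)\<close>, so \<open>s > 8/7\<close> makes
  \<open>h = 2 k\<^sup>2 - (1 - l) s\<close> positive, and the equation for \<open>U\<close> becomes
  \<open>2 U = - h R - T (l - k) D\<close>. As \<open>U \<ge> 0\<close>, this is impossible for \<open>T = 0\<close>, and for \<open>T > 0\<close> it forces
  \<open>D < 0\<close>. The equation for \<open>V\<close> together with \<open>V \<ge> - U\<close> and \<open>n \<ge> 2 k\<^sup>2\<close> then gives
  \<open>D (k - T t - T (l - k)) > 0\<close>, whereas the bracket is nonnegative because the last hypothesis and
  \<open>D < 0\<close> keep \<open>T\<close> small.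
\<close>

lemma spectral_sum_arithmetic:
  fixes l k T t D R n U V :: real
  assumes kl: "k \<le> l" and l1: "l \<le> 1" and T0: "0 \<le> T" and t1: "t \<le> 1" and RT: "T \<le> R"
    and R: "(l + k) * R = k - T * t + T * D"
    and U: "2 * U = (1 - l) * (k - T * t) + D * T * (1 - k) - 2 * k * (k - T * t) + 2 * l * (k * R - T * D)"
    and V: "2 * V = D * (k - T * t) + (1 - l) * T * (1 - k) + 2 * k * (1 - k) * T - 2 * T * n
              - 2 * l * k * T + 2 * l * T * (1 - l)"
    and UV: "0 \<le> U + V" "0 \<le> U - V"
    and n: "2 * k\<^sup>2 \<le> n"
    and P: "2 * k * (R + T) \<le> ((1 - l) + D) * (1 + T)"
  shows "l + k \<le> 8 / 7"
proof (rule ccontr)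
  assume "\<not> l + k \<le> 8 / 7"
  then have s: "l + k > 8 / 7" by simp
  define m where "m = 1 - l"
  have m0: "0 \<le> m" and km: "k > 1 / 7 + m" using l1 s by (auto simp: m_def)
  have k0: "k > 0" using m0 km by linarith
  have U0: "U \<ge> 0" using UV by linarith
  define h where "h = 2 * k\<^sup>2 - (1 - l) * (l + k)"
  have h: "h > 0"
  proof -
    have "8 * h = (4 * k - (l + k))\<^sup>2 + (l + k) * (7 * (l + k) - 8)"
      unfolding h_def by (simp add: power2_eq_square algebra_simps)
    moreover have "(l + k) * (7 * (l + k) - 8) > 0" using s by (intro mult_pos_pos) auto
    ultimately show ?thesis using zero_le_power2[of "4 * k - (l + k)"] by linarith
  qed
  have U': "2 * U = - h * R - T * (l - k) * D"
  proof -
    have "2 * U - (- h * R - T * (l - k) * D) = (1 - l - 2 * k) * (k - T * t + T * D - (l + k) * R)"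
      unfolding U h_def by (simp add: power2_eq_square algebra_simps)
    with R show ?thesis by simp
  qed
  have R0: "R > 0"
  proof (cases "T = 0")
    case True
    with R k0 have "(l + k) * R > 0" by simp
    then show ?thesis using s by (simp add: zero_less_mult_iff)
  qed (use T0 RT in simp)
  have hR: "h * R > 0" using h R0 by simp
  have neg: "T * (l - k) * D < 0" using U' U0 hR by linarith
  then have T: "T > 0" using T0 by (cases "T = 0") auto
  have "T * (l - k) \<ge> 0" using T kl by simp
  with neg have D: "D < 0" by (meson mult_nonneg_nonneg not_less)
  have B: "2 * n + 2 * k\<^sup>2 - m * (1 + k + 2 * l) > 0"
  proof -
    have "6 * k\<^sup>2 - m * k \<ge> 6 * (1 / 7 + m)\<^sup>2 - m * (1 / 7 + m)"
    proof -
      have "6 * k\<^sup>2 - m * k - (6 * (1 / 7 + m)\<^sup>2 - m * (1 / 7 + m))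
        = (k - (1 / 7 + m)) * (6 * (k + (1 / 7 + m)) - m)"
        by (simp add: power2_eq_square algebra_simps)
      moreover have "\<dots> \<ge> 0" using km m0 by (intro mult_nonneg_nonneg) auto
      ultimately show ?thesis by linarith
    qed
    \<comment> \<open>complete squares: the minimum over \<open>m\<close> is attained at \<open>5/49\<close>\<close>
    moreover have "6 * (1 / 7 + m)\<^sup>2 - m * (1 / 7 + m) - m * (1 + 2 * (1 - m)) = 7 * (m - 5 / 49)\<^sup>2 + 17 / 343"
      by (simp add: power2_eq_square algebra_simps)
    moreover have "m * (1 + k + 2 * l) = m * k + m * (1 + 2 * (1 - m))"
      by (simp add: m_def algebra_simps)
    ultimately have "6 * k\<^sup>2 - m * (1 + k + 2 * l) > 0"
      using zero_le_power2[of "m - 5 / 49"] by linarith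
    with n show ?thesis by linarith
  qed
  have small: "T * (1 + l - k) \<le> k"
  proof -
    have "2 * k * (T + T) \<le> 2 * k * (R + T)" using RT k0 by simp
    also note P
    also have "((1 - l) + D) * (1 + T) \<le> m * (1 + T)" using D T by (simp add: m_def)
    finally have TB: "T * (4 * k - m) \<le> m" by (simp add: algebra_simps)
    have pos: "4 * k - m > 0" using km m0 by linarith
    have "m * (1 + l - k) \<le> k * (4 * k - m)"
    proof -
      have "4 * k\<^sup>2 \<ge> 4 * (1 / 7 + m)\<^sup>2" using km m0 by (simp add: power_mono)
      moreover have "4 * (1 / 7 + m)\<^sup>2 - m * (2 - m) = 5 * (m - 3 / 35)\<^sup>2 + 11 / 245"
        by (simp add: power2_eq_square algebra_simps)
      ultimately have "m * (2 - m) \<le> 4 * k\<^sup>2" using zero_le_power2[of "m - 3 / 35"] by linarith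
      moreover have "m * (1 + l - k) = m * (2 - m) - k * m"
        by (simp add: m_def algebra_simps)
      moreover have "k * (4 * k - m) = 4 * k\<^sup>2 - k * m"
        by (simp add: power2_eq_square algebra_simps)
      ultimately show ?thesis by linarith
    qed
    moreover have "T * (4 * k - m) * (1 + l - k) \<le> m * (1 + l - k)"
      using TB kl by (intro mult_right_mono) auto
    ultimately have "T * (1 + l - k) * (4 * k - m) \<le> k * (4 * k - m)"
      by (simp add: algebra_simps)
    then show ?thesis using pos by simp
  qed
  have V': "2 * V = D * (k - T * t) - T * (2 * n + 2 * k\<^sup>2 - m * (1 + k + 2 * l))"
    unfolding V m_def by (simp add: power2_eq_square algebra_simps)
  have "D * (k - T * t) - T * (2 * n + 2 * k\<^sup>2 - m * (1 + k + 2 * l)) > T * (l - k) * D"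
    using V' U' UV hR by linarith
  moreover have "T * (2 * n + 2 * k\<^sup>2 - m * (1 + k + 2 * l)) > 0" using T B by simp
  ultimately have "D * (k - T * t - T * (l - k)) > 0" by (simp add: algebra_simps)
  moreover have "k - T * t - T * (l - k) \<ge> 0"
  proof -
    have "T * t \<le> T" using T t1 by simp
    then show ?thesis using small by (simp add: algebra_simps)
  qed
  ultimately show False using D by (simp add: zero_less_mult_iff)
qed

section \<open>Kernels on a finite weighted set\<close>

locale weighted_set =
  fixes I :: "'a set" and w :: "'a \<Rightarrow> real"
  assumes finite_I: "finite I" and w_pos: "i \<in> I \<Longrightarrow> 0 < w i" and w_sum: "sum w I = 1"
begin

definition E :: "('a \<Rightarrow> real) \<Rightarrow> real" where
  "E u = (\<Sum>i\<in>I. w i * u i)"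

definition app :: "('a \<Rightarrow> 'a \<Rightarrow> real) \<Rightarrow> ('a \<Rightarrow> real) \<Rightarrow> 'a \<Rightarrow> real" where
  "app N u i = E (\<lambda>j. N i j * u j)"

lemma E_cong: "(\<And>i. i \<in> I \<Longrightarrow> u i = v i) \<Longrightarrow> E u = E v"
  unfolding E_def by (intro sum.cong) auto

lemma E_add: "E (\<lambda>i. u i + v i) = E u + E v"
  by (simp add: E_def sum.distrib algebra_simps)

lemma E_diff: "E (\<lambda>i. u i - v i) = E u - E v"
  by (simp add: E_def sum_subtractf algebra_simps)

lemma E_minus: "E (\<lambda>i. - u i) = - E u"
  by (simp add: E_def sum_negf)

lemma E_cmult: "E (\<lambda>i. c * u i) = c * E u"
  by (simp add: E_def sum_distrib_left mult.left_commute)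

lemma E_multc: "E (\<lambda>i. u i * c) = E u * c"
  by (simp add: E_def sum_distrib_right mult.assoc)

lemma E_divide: "E (\<lambda>i. u i / c) = E u / c"
  using E_multc[of u "inverse c"] by (simp add: divide_inverse)

lemma E_const: "E (\<lambda>i. c) = c"
  by (simp add: E_def flip: sum_distrib_right) (simp add: w_sum)

lemmas E_lin = E_add E_diff E_minus E_cmult E_multc E_divide E_const

lemma E_mono: "(\<And>i. i \<in> I \<Longrightarrow> u i \<le> v i) \<Longrightarrow> E u \<le> E v"
  unfolding E_def by (intro sum_mono mult_left_mono) (auto intro: less_imp_le w_pos)

lemma E_nonneg: "(\<And>i. i \<in> I \<Longrightarrow> 0 \<le> u i) \<Longrightarrow> 0 \<le> E u"
  using E_mono[of "\<lambda>_. 0" u] by (simp add: E_const)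

lemma E_nonneg_0: "(\<And>i. i \<in> I \<Longrightarrow> 0 \<le> u i) \<Longrightarrow> E u = 0 \<Longrightarrow> i \<in> I \<Longrightarrow> u i = 0"
  unfolding E_def using w_pos finite_I
  by (subst (asm) sum_nonneg_eq_0_iff) (fastforce intro: mult_nonneg_nonneg less_imp_le)+

lemma E_swap: "E (\<lambda>i. E (\<lambda>j. F i j)) = E (\<lambda>j. E (\<lambda>i. F i j))"
  unfolding E_def sum_distrib_left by (subst sum.swap) (simp add: algebra_simps)

lemma app_self_adjoint:
  assumes "\<And>i j. i \<in> I \<Longrightarrow> j \<in> I \<Longrightarrow> N i j = N j i"
  shows "E (\<lambda>i. u i * app N v i) = E (\<lambda>i. app N u i * v i)"
proof -
  have "E (\<lambda>i. u i * app N v i) = E (\<lambda>i. E (\<lambda>j. u i * (N i j * v j)))"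
    by (simp add: app_def E_cmult)
  also have "\<dots> = E (\<lambda>j. E (\<lambda>i. u i * (N i j * v j)))" by (rule E_swap)
  also have "\<dots> = E (\<lambda>j. E (\<lambda>i. N j i * u i * v j))"
    by (intro E_cong) (simp add: assms algebra_simps)
  finally show ?thesis by (simp add: app_def E_multc)
qed

lemma app_add: "app N (\<lambda>i. u i + v i) i = app N u i + app N v i"
  and app_diff: "app N (\<lambda>i. u i - v i) i = app N u i - app N v i"
  and app_cmult: "app N (\<lambda>i. c * u i) i = c * app N u i"
proof -
  show "app N (\<lambda>i. u i + v i) i = app N u i + app N v i"
    by (simp add: app_def distrib_left E_add)
  show "app N (\<lambda>i. u i - v i) i = app N u i - app N v i"
    by (simp add: app_def right_diff_distrib E_diff)
  show "app N (\<lambda>i. c * u i) i = c * app N u i"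
    unfolding app_def E_cmult[symmetric] by (intro E_cong) simp
qed

lemma app_cong: "(\<And>j. j \<in> I \<Longrightarrow> u j = v j) \<Longrightarrow> app N u i = app N v i"
  unfolding app_def by (intro E_cong) simp

lemma app_nonneg:
  "(\<And>j. j \<in> I \<Longrightarrow> 0 \<le> N i j) \<Longrightarrow> (\<And>j. j \<in> I \<Longrightarrow> 0 \<le> u j) \<Longrightarrow> 0 \<le> app N u i"
  unfolding app_def by (intro E_nonneg) simp

section \<open>Eigenvalues of a kernel with bipartite complement\<close>

text \<open>
  The kernel is \<open>1 - N\<close>, with eigenvectors \<open>f\<close> and \<open>g\<close> for \<open>l\<close> and \<open>k\<close>. The combination
  \<open>h = g - (E g) f\<close> has mean zero, so on it the quadratic form of \<open>1 - N\<close> is that of \<open>- N\<close>, and it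
  is at least \<open>k E h\<^sup>2\<close>. Since \<open>N\<close> lives on pairs of opposite sign of \<open>g\<close>, Cauchy-Schwarz bounds the
  form of \<open>- N\<close> by \<open>sqrt (E N / 2) E h\<^sup>2\<close>. In the proof Cauchy-Schwarz is replaced by the weighted
  inequality between arithmetic and geometric mean, applied pair by pair.
\<close>

lemma nonedge_density:
  fixes N :: "'a \<Rightarrow> 'a \<Rightarrow> real"
  assumes sym: "\<And>i j. i \<in> I \<Longrightarrow> j \<in> I \<Longrightarrow> N i j = N j i"
    and N0: "\<And>i j. i \<in> I \<Longrightarrow> j \<in> I \<Longrightarrow> 0 \<le> N i j"
    and N1: "\<And>i j. i \<in> I \<Longrightarrow> j \<in> I \<Longrightarrow> N i j \<le> 1"
    and bip: "\<And>i j. i \<in> I \<Longrightarrow> j \<in> I \<Longrightarrow> N i j \<noteq> 0 \<Longrightarrow> g i * g j < 0"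
    and f: "\<And>i. i \<in> I \<Longrightarrow> l * f i = E f - app N f i"
    and g: "\<And>i. i \<in> I \<Longrightarrow> k * g i = E g - app N g i"
    and orth: "E (\<lambda>i. f i * g i) = 0"
    and f1: "E f = 1" and g1: "E (\<lambda>i. \<bar>g i\<bar>) = 1" and kl: "k \<le> l" and k: "0 < k"
  shows "2 * k\<^sup>2 \<le> E (app N (\<lambda>_. 1))"
proof -
  define T where "T = E g"
  define h where "h i = g i - T * f i" for i
  define G2 where "G2 = E (\<lambda>i. (g i)\<^sup>2)"
  define F2 where "F2 = E (\<lambda>i. (f i)\<^sup>2)"
  have h0: "E h = 0" by (simp add: h_def[abs_def] E_lin f1 T_def)
  have Nh: "app N h i = - (k * g i - T * (l * f i))" if "i \<in> I" for i
    unfolding h_def[abs_def] by (simp add: app_diff app_cmult f[OF that] g[OF that] f1 right_diff_distrib flip: T_def)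
  have orth': "E (\<lambda>i. g i * f i) = 0" using orth by (simp add: mult.commute)
  define h2 where "h2 = E (\<lambda>i. (h i)\<^sup>2)"
  have h2: "h2 = G2 + T\<^sup>2 * F2"
  proof -
    have "h2 = E (\<lambda>i. (g i)\<^sup>2 - 2 * T * (f i * g i) + T\<^sup>2 * (f i)\<^sup>2)"
      unfolding h2_def by (intro E_cong) (simp add: h_def power2_eq_square algebra_simps)
    then show ?thesis by (simp only: E_lin orth G2_def F2_def)
  qed
  have "E (\<lambda>i. h i * app N h i) = E (\<lambda>i. (k + l) * T * (f i * g i) - k * (g i)\<^sup>2 - T\<^sup>2 * l * (f i)\<^sup>2)"
    by (intro E_cong) (simp add: Nh h_def power2_eq_square algebra_simps)
  also have "\<dots> = - (k * G2) - T\<^sup>2 * l * F2"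
    by (simp only: E_lin orth G2_def F2_def)
  finally have hNh: "E (\<lambda>i. h i * app N h i) = - (k * G2) - T\<^sup>2 * l * F2" .
  have F20: "F2 \<ge> 0" unfolding F2_def by (intro E_nonneg) simp
  have G20: "G2 > 0"
  proof -
    have "G2 \<noteq> 0"
    proof
      assume "G2 = 0"
      then have *: "E (\<lambda>i. (g i)\<^sup>2) = 0" by (simp only: G2_def)
      have "(g i)\<^sup>2 = 0" if "i \<in> I" for i
        by (rule E_nonneg_0[OF _ * that]) simp
      then have "E (\<lambda>i. \<bar>g i\<bar>) = E (\<lambda>i. 0)" by (intro E_cong) auto
      then show False using g1 by (simp add: E_const)
    qed
    moreover have "G2 \<ge> 0" unfolding G2_def by (intro E_nonneg) simp
    ultimately show ?thesis by simp
  qed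
  have h2pos: "h2 > 0" using h2 G20 F20 by (simp add: add_pos_nonneg)
  have lower: "k * h2 \<le> - E (\<lambda>i. h i * app N h i)"
  proof -
    have "k * (T\<^sup>2 * F2) \<le> l * (T\<^sup>2 * F2)" using kl F20 by (intro mult_right_mono) auto
    then show ?thesis unfolding hNh h2 by (simp add: algebra_simps)
  qed
  define x where "x i = (if g i \<ge> 0 then 1 else -1 :: real)" for i
  \<comment> \<open>the optimal weight for the pairwise estimate below in the case \<open>E N = 2 k\<^sup>2\<close>\<close>
  define th where "th = h2 / (2 * k)"
  have th: "th > 0" using h2pos k by (simp add: th_def)
  \<comment> \<open>\<open>h2\<^sup>2 - X\<^sup>2\<close> is four times the product of the two one-sided integrals of \<open>h\<^sup>2\<close>\<close>
  define X where "X = E (\<lambda>i. x i * (h i)\<^sup>2)"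
  have "- E (\<lambda>i. h i * app N h i) = E (\<lambda>i. E (\<lambda>j. - (h i * (N i j * h j))))"
    by (simp add: app_def E_lin)
  also have "\<dots> \<le> E (\<lambda>i. E (\<lambda>j. (th / 2) * N i j + 1 / (4 * th) * ((h i)\<^sup>2 * (h j)\<^sup>2 - x i * (h i)\<^sup>2 * (x j * (h j)\<^sup>2))))"
  proof (intro E_mono)
    fix i j assume ij: "i \<in> I" "j \<in> I"
    show "- (h i * (N i j * h j)) \<le> (th / 2) * N i j + 1 / (4 * th) * ((h i)\<^sup>2 * (h j)\<^sup>2 - x i * (h i)\<^sup>2 * (x j * (h j)\<^sup>2))"
    proof (cases "N i j = 0")
      case True
      have "x i * x j \<le> 1" by (simp add: x_def)
      then have "(x i * x j) * ((h i)\<^sup>2 * (h j)\<^sup>2) \<le> 1 * ((h i)\<^sup>2 * (h j)\<^sup>2)"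
        by (intro mult_right_mono) auto
      then have "0 \<le> 1 / (4 * th) * ((h i)\<^sup>2 * (h j)\<^sup>2 - x i * (h i)\<^sup>2 * (x j * (h j)\<^sup>2))"
        using th by (intro mult_nonneg_nonneg) (auto simp: mult_ac)
      then show ?thesis using True by simp
    next
      case False
      have xx: "x i * x j = -1" using bip[OF ij False] by (auto simp: x_def mult_less_0_iff)
      have "x i * (h i)\<^sup>2 * (x j * (h j)\<^sup>2) = (x i * x j) * ((h i)\<^sup>2 * (h j)\<^sup>2)" by simp
      then have e: "(h i)\<^sup>2 * (h j)\<^sup>2 - x i * (h i)\<^sup>2 * (x j * (h j)\<^sup>2) = 2 * (h i * h j)\<^sup>2"
        by (simp add: xx power_mult_distrib)
      define y where "y = h i * h j"
      have "0 \<le> (th + y)\<^sup>2" by simp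
      then have "- y \<le> th / 2 + 1 / (2 * th) * y\<^sup>2"
        using th by (simp add: field_simps power2_eq_square)
      then have "N i j * (- y) \<le> N i j * (th / 2 + 1 / (2 * th) * y\<^sup>2)"
        using N0[OF ij] by (rule mult_left_mono)
      also have "\<dots> \<le> N i j * (th / 2) + 1 * (1 / (2 * th) * y\<^sup>2)"
        unfolding distrib_left using N1[OF ij] th by (intro add_left_mono mult_right_mono) auto
      finally show ?thesis unfolding e y_def by (simp add: algebra_simps)
    qed
  qed
  also have "\<dots> = th / 2 * E (app N (\<lambda>_. 1)) + 1 / (4 * th) * (h2\<^sup>2 - X\<^sup>2)"
  proof -
    have *: "app N (\<lambda>_. 1) = (\<lambda>i. E (\<lambda>j. N i j))" by (rule ext) (simp add: app_def)
    show ?thesis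
      by (simp only: * E_lin h2_def[symmetric] X_def[symmetric]) (simp add: power2_eq_square)
  qed
  also have "\<dots> \<le> th / 2 * E (app N (\<lambda>_. 1)) + 1 / (4 * th) * h2\<^sup>2"
    using th by (intro add_left_mono mult_left_mono) auto
  finally have "k * h2 \<le> th / 2 * E (app N (\<lambda>_. 1)) + 1 / (4 * th) * h2\<^sup>2" using lower by simp
  also have "\<dots> = h2 * (E (app N (\<lambda>_. 1)) / (4 * k) + k / 2)"
    unfolding th_def using h2pos k by (simp add: field_simps power2_eq_square)
  finally have "k \<le> E (app N (\<lambda>_. 1)) / (4 * k) + k / 2"
    using h2pos by (simp add: mult.commute)
  then show ?thesis using k by (simp add: field_simps power2_eq_square)
qed

text \<open>
  Write \<open>x\<close> for the sign of \<open>g\<close>, \<open>p = \<bar>g\<bar>\<close> and \<open>q = N f = 1 - l f\<close>, so that \<open>q \<ge> 0\<close> and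
  \<open>E q = 1 - l\<close>. Bipartiteness of \<open>N\<close> says that \<open>N\<close> anticommutes with multiplication by \<open>x\<close>, which
  turns the eigenvalue equation of \<open>g\<close> into \<open>c = N p = k p - T x\<close>, where \<open>T = E g\<close>; in particular
  \<open>k p \<le> (1 + x T) / 2\<close>, since \<open>N \<le> 1\<close>.

  If \<open>T = 0\<close> this already suffices: self-adjointness gives \<open>(l + k) E (q p) = k\<close>, whence
  \<open>1 - l = E q \<ge> 2 k E (q p) = 2 k\<^sup>2 / (l + k)\<close>, which implies \<open>l + k \<le> 8/7\<close>. The slack in that
  inequality is an integral of \<open>q\<close> and \<open>p\<close> against the edges between the two sides. For general
  \<open>T\<close> the integrand \<open>p\<close> must be replaced by \<open>c\<close>, which vanishes at points adjacent to everything: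
  with \<open>M\<close> the part of \<open>1 - N\<close> on pairs of opposite signs, both \<open>E (q (M c))\<close> and
  \<open>E (x q (M c))\<close> can be computed, and the first dominates the second in absolute value. They are
  \<open>U\<close> and \<open>V\<close>.
\<close>

lemma eigenvalue_sum_bound_normalized:
  fixes N :: "'a \<Rightarrow> 'a \<Rightarrow> real"
  assumes sym: "\<And>i j. i \<in> I \<Longrightarrow> j \<in> I \<Longrightarrow> N i j = N j i"
    and N0: "\<And>i j. i \<in> I \<Longrightarrow> j \<in> I \<Longrightarrow> 0 \<le> N i j"
    and N1: "\<And>i j. i \<in> I \<Longrightarrow> j \<in> I \<Longrightarrow> N i j \<le> 1"
    and bip: "\<And>i j. i \<in> I \<Longrightarrow> j \<in> I \<Longrightarrow> N i j \<noteq> 0 \<Longrightarrow> g i * g j < 0"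
    and f: "\<And>i. i \<in> I \<Longrightarrow> l * f i = E f - app N f i"
    and g: "\<And>i. i \<in> I \<Longrightarrow> k * g i = E g - app N g i"
    and orth: "E (\<lambda>i. f i * g i) = 0" and f0: "\<And>i. i \<in> I \<Longrightarrow> 0 \<le> f i"
    and f1: "E f = 1" and g1: "E (\<lambda>i. \<bar>g i\<bar>) = 1" and kl: "k \<le> l" and T0: "0 \<le> E g"
  shows "l + k \<le> 8 / 7"
proof -
  define T where "T = E g"
  define x where "x i = (if g i \<ge> 0 then 1 else -1 :: real)" for i
  define p where "p i = \<bar>g i\<bar>" for i
  define q where "q = app N f"
  define d where "d = app N (\<lambda>_. 1)"
  define c where "c = app N p"
  define R where "R = E (\<lambda>i. q i * p i)"
  define D where "D = E (\<lambda>i. x i * q i)"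
  define t where "t = E x"
  define n where "n = E d"
  have xx: "x i * x i = 1" and gx: "g i = x i * p i" and px: "x i * g i = p i" for i
    by (auto simp: x_def p_def)
  have q: "q i = 1 - l * f i" if "i \<in> I" for i using f[OF that] by (simp add: q_def f1)
  have q0: "0 \<le> q i" if "i \<in> I" for i
    unfolding q_def using that by (intro app_nonneg) (auto simp: N0 f0)
  have p0: "0 \<le> p i" for i by (simp add: p_def)
  have c0: "0 \<le> c i" if "i \<in> I" for i
    unfolding c_def using that by (intro app_nonneg) (auto simp: N0 p0)
  \<comment> \<open>\<open>N\<close> anticommutes with the sign \<open>x\<close>\<close>
  have Nx: "N i j * x j = - (x i * N i j)" if "i \<in> I" "j \<in> I" for i j
    using bip[OF that] by (cases "N i j = 0") (auto simp: x_def mult_less_0_iff)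
  have app_x: "app N (\<lambda>j. x j * u j) i = - (x i * app N u i)" if "i \<in> I" for u i
  proof -
    have "app N (\<lambda>j. x j * u j) i = E (\<lambda>j. - (x i * (N i j * u j)))"
      unfolding app_def using Nx[OF that] by (intro E_cong) (metis mult.assoc mult_minus_left)
    then show ?thesis by (simp add: E_lin app_def)
  qed
  have c: "c i = k * p i - T * x i" if "i \<in> I" for i
  proof -
    have "c i = app N (\<lambda>j. x j * g j) i" by (simp add: c_def px)
    also have "\<dots> = - (x i * app N g i)" by (rule app_x[OF that])
    also have "app N g i = T - k * g i" using g[OF that] by (simp add: T_def)
    also have "- (x i * (T - k * g i)) = k * p i - T * x i"
      using px[of i] by (simp add: algebra_simps)
    finally show ?thesis .
  qed
  have Nq: "app N q i = d i - l * q i" if "i \<in> I" for i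
  proof -
    have "app N q i = app N (\<lambda>j. 1 - l * f j) i" by (intro app_cong) (simp add: q)
    then show ?thesis by (simp add: app_diff app_cmult d_def q_def)
  qed
  have sa: "E (\<lambda>i. u i * app N v i) = E (\<lambda>i. app N u i * v i)" for u v
    by (rule app_self_adjoint[OF sym])
  have Eq: "E q = 1 - l"
  proof -
    have "E q = E (\<lambda>i. 1 - l * f i)" by (intro E_cong) (rule q)
    then show ?thesis by (simp add: E_lin f1)
  qed
  have Ep: "E p = 1" using g1 by (simp add: p_def[abs_def])
  have Exp: "E (\<lambda>i. x i * p i) = T" by (simp add: T_def flip: gx)
  have Eqg: "E (\<lambda>i. q i * g i) = T"
  proof -
    have "E (\<lambda>i. q i * g i) = E (\<lambda>i. g i - l * (f i * g i))"
      by (intro E_cong) (simp add: q algebra_simps)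
    then show ?thesis by (simp add: E_lin orth T_def)
  qed
  have Ec: "E c = k - T * t"
  proof -
    have "E c = E (\<lambda>i. k * p i - T * x i)" by (intro E_cong) (rule c)
    then show ?thesis by (simp add: E_lin Ep t_def)
  qed
  have Exc: "E (\<lambda>i. x i * c i) = k * T - T"
  proof -
    have "E (\<lambda>i. x i * c i) = E (\<lambda>i. k * (x i * p i) - T * 1)"
      by (intro E_cong) (simp add: c right_diff_distrib xx mult.left_commute[of "x _"])
    then show ?thesis by (simp add: E_lin Exp)
  qed
  have Edp: "E (\<lambda>i. d i * p i) = k - T * t"
    using sa[of "\<lambda>_. 1" p] by (simp add: d_def Ec flip: c_def)
  have Edx: "E (\<lambda>i. d i * x i) = 0"
  proof -
    have "E (\<lambda>i. d i * x i) = E (app N (\<lambda>j. x j * 1))"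
      using sa[of "\<lambda>_. 1" x] by (simp add: d_def)
    also have "\<dots> = E (\<lambda>i. - (d i * x i))"
      by (intro E_cong) (subst app_x, auto simp: d_def)
    finally show ?thesis by (simp add: E_minus)
  qed
  have Edg: "E (\<lambda>i. d i * g i) = T - k * T"
  proof -
    have "E (\<lambda>i. d i * g i) = E (app N g)" using sa[of "\<lambda>_. 1" g] by (simp add: d_def)
    also have "\<dots> = E (\<lambda>i. T - k * g i)" by (intro E_cong) (use g in \<open>simp add: T_def\<close>)
    finally show ?thesis by (simp add: E_lin T_def)
  qed
  have Eqc: "E (\<lambda>i. q i * c i) = k * R - T * D"
  proof -
    have "E (\<lambda>i. q i * c i) = E (\<lambda>i. k * (q i * p i) - T * (x i * q i))"
      by (intro E_cong) (simp add: c algebra_simps)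
    then show ?thesis by (simp add: E_lin R_def D_def)
  qed
  have Eqc': "E (\<lambda>i. q i * c i) = k - T * t - l * R"
  proof -
    have "E (\<lambda>i. q i * c i) = E (\<lambda>i. app N q i * p i)" unfolding c_def by (rule sa)
    also have "\<dots> = E (\<lambda>i. d i * p i - l * (q i * p i))"
      by (intro E_cong) (simp add: Nq algebra_simps)
    finally show ?thesis by (simp add: E_lin Edp R_def)
  qed
  \<comment> \<open>\<open>E (q c)\<close> computed from the equation for \<open>c\<close> and, by self-adjointness, from that for \<open>N q\<close>\<close>
  have R: "(l + k) * R = k - T * t + T * D" using Eqc Eqc' by (simp add: algebra_simps)
  \<comment> \<open>\<open>m = M c\<close>, where \<open>M = (1 - x x') / 2 - N\<close> is \<open>1 - N\<close> on opposite signs and \<open>0\<close> elsewhere\<close>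
  define m where "m i = E (\<lambda>j. ((1 - x i * x j) / 2 - N i j) * c j)" for i
  have m: "m i = (E c - x i * E (\<lambda>j. x j * c j)) / 2 - app N c i" for i
  proof -
    have "m i = E (\<lambda>j. (c j - x i * (x j * c j)) * (1 / 2) - N i j * c j)"
      unfolding m_def by (intro E_cong) (simp add: field_simps)
    then show ?thesis by (simp add: E_lin app_def)
  qed
  have m0: "0 \<le> m i" if i: "i \<in> I" for i
    unfolding m_def
  proof (intro E_nonneg mult_nonneg_nonneg)
    fix j assume j: "j \<in> I"
    show "0 \<le> (1 - x i * x j) / 2 - N i j"
      using N1[OF i j] bip[OF i j] by (cases "N i j = 0") (auto simp: x_def mult_less_0_iff)
    show "0 \<le> c j" by (rule c0[OF j])
  qed
  define U where "U = E (\<lambda>i. q i * m i)"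
  define V where "V = E (\<lambda>i. x i * q i * m i)"
  have UV: "0 \<le> U + V" "0 \<le> U - V"
  proof -
    have "0 \<le> E (\<lambda>i. (1 + x i) * (q i * m i))" "0 \<le> E (\<lambda>i. (1 - x i) * (q i * m i))"
      by (intro E_nonneg mult_nonneg_nonneg; auto simp: x_def q0 m0)+
    moreover have "E (\<lambda>i. (1 + x i) * (q i * m i)) = U + V" "E (\<lambda>i. (1 - x i) * (q i * m i)) = U - V"
      unfolding U_def V_def E_add[symmetric] E_diff[symmetric] by (simp_all add: algebra_simps)
    ultimately show "0 \<le> U + V" "0 \<le> U - V" by simp_all
  qed
  have EqNc: "E (\<lambda>i. q i * app N c i) = k * (k - T * t) - l * (k * R - T * D)"
  proof -
    have "E (\<lambda>i. q i * app N c i) = E (\<lambda>i. app N q i * c i)" by (rule sa)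
    also have "\<dots> = E (\<lambda>i. k * (d i * p i) - T * (d i * x i) - l * (q i * c i))"
      by (intro E_cong) (simp add: Nq c algebra_simps)
    finally show ?thesis by (simp add: E_lin Edp Edx Eqc)
  qed
  have U: "2 * U = (1 - l) * (k - T * t) + D * T * (1 - k) - 2 * k * (k - T * t) + 2 * l * (k * R - T * D)"
  proof -
    have "U = E (\<lambda>i. q i * (E c / 2) - (x i * q i) * (E (\<lambda>j. x j * c j) / 2) - q i * app N c i)"
      unfolding U_def by (intro E_cong) (simp add: m algebra_simps diff_divide_distrib)
    also have "\<dots> = (1 - l) * (E c / 2) - D * (E (\<lambda>j. x j * c j) / 2) - E (\<lambda>i. q i * app N c i)"
      by (simp only: E_lin Eq D_def)
    finally have "2 * U = (1 - l) * E c - D * E (\<lambda>j. x j * c j) - 2 * E (\<lambda>i. q i * app N c i)"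
      by simp
    then show ?thesis unfolding Ec Exc EqNc by (simp add: algebra_simps)
  qed
  have ExqNc: "E (\<lambda>i. x i * q i * app N c i)
      = - (k * (T - k * T) - T * n) + l * (k * T - T * (1 - l))"
  proof -
    have "E (\<lambda>i. x i * q i * app N c i) = E (\<lambda>i. app N (\<lambda>j. x j * q j) i * c i)" by (rule sa)
    also have "\<dots> = E (\<lambda>i. - (k * (d i * g i) - T * d i) + l * (k * (q i * g i) - T * q i))"
    proof (intro E_cong)
      fix i assume i: "i \<in> I"
      have "x i * c i = k * (x i * p i) - T * (x i * x i)"
        by (simp add: c[OF i] algebra_simps)
      then have xc: "x i * c i = k * g i - T" by (simp only: xx gx mult_1_right)
      have "app N (\<lambda>j. x j * q j) i * c i = - (d i - l * q i) * (x i * c i)"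
        by (subst app_x[OF i]) (simp add: Nq[OF i] algebra_simps)
      also note xc
      finally show "app N (\<lambda>j. x j * q j) i * c i
        = - (k * (d i * g i) - T * d i) + l * (k * (q i * g i) - T * q i)"
        by (simp add: algebra_simps)
    qed
    finally show ?thesis by (simp only: E_lin Edg Eqg Eq n_def)
  qed
  have V: "2 * V = D * (k - T * t) + (1 - l) * T * (1 - k) + 2 * k * (1 - k) * T - 2 * T * n
      - 2 * l * k * T + 2 * l * T * (1 - l)"
  proof -
    have "V = E (\<lambda>i. (x i * q i) * (E c / 2) - q i * (E (\<lambda>j. x j * c j) / 2) - x i * q i * app N c i)"
      unfolding V_def
    proof (intro E_cong)
      fix i
      have "x i * q i * (x i * y) = q i * y" for y by (simp add: x_def)
      note this[of "E (\<lambda>j. x j * c j) / 2"]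
      then show "x i * q i * m i = (x i * q i) * (E c / 2) - q i * (E (\<lambda>j. x j * c j) / 2) - x i * q i * app N c i"
        by (simp add: m right_diff_distrib diff_divide_distrib)
    qed
    also have "\<dots> = D * (E c / 2) - (1 - l) * (E (\<lambda>j. x j * c j) / 2) - E (\<lambda>i. x i * q i * app N c i)"
      by (simp only: E_lin Eq D_def)
    finally have "2 * V = D * E c - (1 - l) * E (\<lambda>j. x j * c j) - 2 * E (\<lambda>i. x i * q i * app N c i)"
      by simp
    then show ?thesis unfolding Ec Exc ExqNc by (simp add: algebra_simps)
  qed
  have Exqp: "E (\<lambda>i. x i * q i * p i) = T"
  proof -
    have "E (\<lambda>i. x i * q i * p i) = E (\<lambda>i. q i * g i)"
      by (intro E_cong) (simp add: x_def p_def)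
    then show ?thesis using Eqg by simp
  qed
  have RT: "T \<le> R"
  proof -
    have "0 \<le> E (\<lambda>i. (1 - x i) * (q i * p i))"
      by (intro E_nonneg mult_nonneg_nonneg; auto simp: x_def q0 p0)
    also have "\<dots> = R - E (\<lambda>i. x i * q i * p i)"
      unfolding R_def E_diff[symmetric] by (simp add: algebra_simps)
    finally show ?thesis by (simp add: Exqp)
  qed
  have kp: "k * p i \<le> (1 + x i * T) / 2" if i: "i \<in> I" for i
  proof -
    have "c i \<le> E (\<lambda>j. (1 - x i * x j) / 2 * p j)"
      unfolding c_def app_def
    proof (intro E_mono mult_right_mono)
      fix j assume j: "j \<in> I"
      show "N i j \<le> (1 - x i * x j) / 2"
        using N1[OF i j] bip[OF i j] by (cases "N i j = 0") (auto simp: x_def mult_less_0_iff)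
    qed (rule p0)
    also have "\<dots> = E (\<lambda>j. (p j - x i * (x j * p j)) * (1 / 2))"
      by (intro E_cong) (simp add: field_simps)
    also have "\<dots> = (1 - x i * T) / 2" by (simp add: E_lin Ep Exp)
    finally show ?thesis using c[OF i] by (simp add: algebra_simps)
  qed
  have P: "2 * k * (R + T) \<le> ((1 - l) + D) * (1 + T)"
  proof -
    have "k * (R + T) = E (\<lambda>i. ((1 + x i) * q i) * (k * p i))"
    proof -
      have "k * (R + T) = k * (R + E (\<lambda>i. x i * q i * p i))" by (simp add: Exqp)
      also have "\<dots> = E (\<lambda>i. ((1 + x i) * q i) * (k * p i))"
        unfolding R_def E_add[symmetric] E_cmult[symmetric] by (simp add: algebra_simps)
      finally show ?thesis .
    qed
    also have "\<dots> \<le> E (\<lambda>i. ((1 + x i) * q i) * ((1 + T) / 2))"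
    proof (intro E_mono)
      fix i assume i: "i \<in> I"
      show "((1 + x i) * q i) * (k * p i) \<le> ((1 + x i) * q i) * ((1 + T) / 2)"
      proof (cases "x i = 1")
        case True
        then show ?thesis using kp[OF i] q0[OF i] by (intro mult_left_mono) auto
      next
        case False
        then have "x i = -1" by (simp add: x_def split: if_splits)
        then show ?thesis by simp
      qed
    qed
    also have "\<dots> = E (\<lambda>i. q i + x i * q i) * ((1 + T) / 2)"
      unfolding E_multc by (simp add: algebra_simps)
    also have "\<dots> = ((1 - l) + D) * ((1 + T) / 2)" by (simp add: E_add Eq D_def)
    finally show ?thesis by simp
  qed
  have l1: "l \<le> 1" using E_nonneg[of q] q0 Eq by simp
  have t1: "t \<le> 1"
    using E_mono[of x "\<lambda>_. 1"] by (simp add: t_def E_const x_def)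
  show ?thesis
  proof (cases "k > 0")
    case True
    have n: "2 * k\<^sup>2 \<le> n" unfolding n_def d_def
      by (rule nonedge_density[OF sym N0 N1 bip f g orth f1 g1 kl True])
    show ?thesis
      by (rule spectral_sum_arithmetic[OF kl l1 _ t1 RT R U V UV n P]) (use T0 in \<open>simp add: T_def\<close>)
  next
    case False
    with l1 show ?thesis by simp
  qed
qed

section \<open>The two largest eigenvalues on a finite weighted set\<close>

definition Q :: "('a \<Rightarrow> 'a \<Rightarrow> real) \<Rightarrow> ('a \<Rightarrow> real) \<Rightarrow> real" where
  "Q M u = E (\<lambda>i. u i * app M u i)"

definition orthonormal :: "('a \<Rightarrow> real) \<Rightarrow> ('a \<Rightarrow> real) \<Rightarrow> bool" where
  "orthonormal u v \<longleftrightarrow> E (\<lambda>i. (u i)\<^sup>2) = 1 \<and> E (\<lambda>i. (v i)\<^sup>2) = 1 \<and> E (\<lambda>i. u i * v i) = 0"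

lemma Q_cong: "(\<And>i. i \<in> I \<Longrightarrow> u i = v i) \<Longrightarrow> Q M u = Q M v"
  unfolding Q_def by (intro E_cong arg_cong2[where f = times]) (auto intro: app_cong)

lemma Q_scale: "Q M (\<lambda>i. c * u i) = c\<^sup>2 * Q M u"
proof -
  have "Q M (\<lambda>i. c * u i) = E (\<lambda>i. c\<^sup>2 * (u i * app M u i))"
    unfolding Q_def app_cmult by (intro E_cong) (simp add: power2_eq_square)
  then show ?thesis by (simp add: E_cmult Q_def)
qed

lemma E_square_0:
  assumes "E (\<lambda>i. (u i)\<^sup>2) = 0" "i \<in> I"
  shows "u i = 0"
  using E_nonneg_0[OF _ assms] by simp

lemma E_square_nonneg: "0 \<le> E (\<lambda>i. (u i)\<^sup>2)"
  by (intro E_nonneg) simp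

text \<open>
  Values outside \<open>I\<close> are irrelevant, so the candidates may be taken to vanish there; they then form
  a compact subset of a product of intervals. The linear constraint serves to look for a second
  eigenvector orthogonal to a first one.
\<close>

lemma maximizer_exists:
  assumes u0: "E (\<lambda>i. (u0 i)\<^sup>2) = 1" "E (\<lambda>i. f i * u0 i) = 0"
  obtains u where "E (\<lambda>i. (u i)\<^sup>2) = 1" "E (\<lambda>i. f i * u i) = 0"
    and "\<And>v. E (\<lambda>i. (v i)\<^sup>2) = 1 \<Longrightarrow> E (\<lambda>i. f i * v i) = 0 \<Longrightarrow> Q M v \<le> Q M u"
proof -
  \<comment> \<open>the width comes from \<open>\<bar>v i\<bar> \<le> 1 + (v i)\<^sup>2\<close> and \<open>w i * (v i)\<^sup>2 \<le> 1\<close>\<close>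
  define box where "box i = (if i \<in> I then {- (1 + 1 / w i) .. 1 + 1 / w i} else {0 :: real})" for i
  define S where "S = PiE UNIV box \<inter> {u. E (\<lambda>i. (u i)\<^sup>2) = 1} \<inter> {u. E (\<lambda>i. f i * u i) = 0}"
  have "compactin (product_topology (\<lambda>_. euclidean) UNIV) (PiE UNIV box)"
    unfolding compactin_PiE by (simp add: box_def)
  then have "compact (PiE UNIV box)" by (simp add: euclidean_product_topology)
  moreover have cont: "continuous_on UNIV (\<lambda>u :: 'a \<Rightarrow> real. E (\<lambda>i. (u i)\<^sup>2))"
      "continuous_on UNIV (\<lambda>u :: 'a \<Rightarrow> real. E (\<lambda>i. f i * u i))"
      "continuous_on UNIV (\<lambda>u :: 'a \<Rightarrow> real. Q M u)"
    unfolding Q_def app_def E_def by (intro continuous_intros continuous_on_product_coordinates)+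
  ultimately have "compact S"
    unfolding S_def by (intro compact_Int_closed closed_Collect_eq continuous_on_const)
  define res where "res u i = (if i \<in> I then u i else 0)" for u :: "'a \<Rightarrow> real" and i
  have res: "E (\<lambda>i. (res v i)\<^sup>2) = E (\<lambda>i. (v i)\<^sup>2)" "E (\<lambda>i. f i * res v i) = E (\<lambda>i. f i * v i)"
    "Q M (res v) = Q M v" for v
    by (auto intro!: E_cong Q_cong simp: res_def)
  have resS: "res v \<in> S" if v: "E (\<lambda>i. (v i)\<^sup>2) = 1" "E (\<lambda>i. f i * v i) = 0" for v
  proof -
    have "\<bar>v i\<bar> \<le> 1 + 1 / w i" if i: "i \<in> I" for i
    proof -
      have "w i * (v i)\<^sup>2 \<le> (\<Sum>i\<in>I. w i * (v i)\<^sup>2)"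
        using i finite_I by (intro member_le_sum) (auto intro!: mult_nonneg_nonneg less_imp_le[OF w_pos])
      then have "(v i)\<^sup>2 \<le> 1 / w i" using v(1) w_pos[OF i] by (simp add: E_def field_simps)
      moreover have "\<bar>v i\<bar> \<le> 1 + (v i)\<^sup>2"
        using zero_le_power2[of "\<bar>v i\<bar> - 1"] by (simp add: power2_diff)
      ultimately show ?thesis by simp
    qed
    then have "res v i \<in> box i" for i
      by (fastforce simp add: res_def box_def abs_le_iff)
    then show ?thesis unfolding S_def using v by (auto simp: res)
  qed
  have "S \<noteq> {}" using resS[OF u0] by blast
  then obtain u where u: "u \<in> S" "\<And>v. v \<in> S \<Longrightarrow> Q M v \<le> Q M u"
    using continuous_attains_sup[OF \<open>compact S\<close> _ continuous_on_subset[OF cont(3)]] by blast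
  show thesis
  proof (rule that[of u])
    fix v assume "E (\<lambda>i. (v i)\<^sup>2) = 1" "E (\<lambda>i. f i * v i) = 0"
    from u(2)[OF resS[OF this]] show "Q M v \<le> Q M u" by (simp add: res)
  qed (use u(1) in \<open>auto simp: S_def\<close>)
qed

text \<open>
  First-order condition: the defect \<open>r = M u - Q(u) u\<close> is orthogonal to both \<open>f\<close> and \<open>u\<close>, so
  \<open>u + e r\<close> is an admissible direction, along which the quadratic form would grow at the rate
  \<open>2 e E r\<^sup>2\<close> while the squared norm changes only by a term of order \<open>e\<^sup>2\<close>.
\<close>

lemma maximizer_eigen:
  assumes sym: "\<And>i j. i \<in> I \<Longrightarrow> j \<in> I \<Longrightarrow> M i j = M j i"
    and f: "\<And>i. i \<in> I \<Longrightarrow> app M f i = l * f i"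
    and u: "E (\<lambda>i. (u i)\<^sup>2) = 1" "E (\<lambda>i. f i * u i) = 0"
    and max: "\<And>v. E (\<lambda>i. (v i)\<^sup>2) = 1 \<Longrightarrow> E (\<lambda>i. f i * v i) = 0 \<Longrightarrow> Q M v \<le> Q M u"
    and i: "i \<in> I"
  shows "app M u i = Q M u * u i"
proof -
  have sa: "E (\<lambda>i. x i * app M y i) = E (\<lambda>i. app M x i * y i)" for x y
    by (rule app_self_adjoint[OF sym])
  have max': "Q M v \<le> Q M u * E (\<lambda>i. (v i)\<^sup>2)" if v: "E (\<lambda>i. f i * v i) = 0" for v
  proof (cases "E (\<lambda>i. (v i)\<^sup>2) = 0")
    case True
    have "Q M v = Q M (\<lambda>i. 0 * v i)" by (rule Q_cong) (simp add: E_square_0[OF True])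
    also have "\<dots> = 0" by (subst Q_scale) simp
    finally show ?thesis by (simp add: True)
  next
    case False
    define s where "s = E (\<lambda>i. (v i)\<^sup>2)"
    have s: "s > 0" using False E_square_nonneg[of v] by (simp add: s_def)
    define c where "c = 1 / sqrt s"
    have c: "c\<^sup>2 = 1 / s" using s by (simp add: c_def power_divide)
    have "Q M (\<lambda>i. c * v i) \<le> Q M u"
    proof (rule max)
      show "E (\<lambda>i. (c * v i)\<^sup>2) = 1"
        using s by (simp add: power_mult_distrib E_divide c flip: s_def)
      have "E (\<lambda>i. f i * (c * v i)) = E (\<lambda>i. c * (f i * v i))" by (simp add: mult.left_commute)
      then show "E (\<lambda>i. f i * (c * v i)) = 0" by (simp add: E_cmult v)
    qed
    then show ?thesis using s by (simp add: Q_scale c field_simps flip: s_def)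
  qed
  define r where "r i = app M u i - Q M u * u i" for i
  have fr: "E (\<lambda>i. f i * r i) = 0"
  proof -
    have "E (\<lambda>i. f i * r i) = E (\<lambda>i. f i * app M u i) - Q M u * E (\<lambda>i. f i * u i)"
      unfolding E_cmult[symmetric] E_diff[symmetric] by (simp add: r_def algebra_simps)
    also have "E (\<lambda>i. f i * app M u i) = E (\<lambda>i. l * (f i * u i))"
      unfolding sa by (intro E_cong) (simp add: f)
    finally show ?thesis by (simp add: E_cmult u)
  qed
  have ur: "E (\<lambda>i. u i * r i) = 0"
  proof -
    have "E (\<lambda>i. u i * r i) = E (\<lambda>i. u i * app M u i) - Q M u * E (\<lambda>i. (u i)\<^sup>2)"
      unfolding E_cmult[symmetric] E_diff[symmetric]
      by (simp add: r_def algebra_simps power2_eq_square)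
    then show ?thesis by (simp add: u Q_def)
  qed
  define r2 where "r2 = E (\<lambda>i. (r i)\<^sup>2)"
  have Mur: "E (\<lambda>i. app M u i * r i) = r2"
  proof -
    have "r2 = E (\<lambda>i. app M u i * r i - Q M u * (u i * r i))"
      unfolding r2_def by (intro E_cong) (simp add: r_def power2_eq_square algebra_simps)
    then show ?thesis by (simp add: E_diff E_cmult ur)
  qed
  have r20: "r2 \<ge> 0" unfolding r2_def by (rule E_square_nonneg)
  have ineq: "2 * e * r2 \<le> e\<^sup>2 * (Q M u * r2 - Q M r)" for e
  proof -
    have "Q M (\<lambda>i. u i + e * r i) \<le> Q M u * E (\<lambda>i. (u i + e * r i)\<^sup>2)"
    proof (rule max')
      have "E (\<lambda>i. f i * (u i + e * r i)) = E (\<lambda>i. f i * u i) + e * E (\<lambda>i. f i * r i)"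
        unfolding E_cmult[symmetric] E_add[symmetric] by (simp add: algebra_simps)
      then show "E (\<lambda>i. f i * (u i + e * r i)) = 0" by (simp add: u fr)
    qed
    moreover have "E (\<lambda>i. (u i + e * r i)\<^sup>2) = 1 + e\<^sup>2 * r2"
    proof -
      have "E (\<lambda>i. (u i + e * r i)\<^sup>2) = E (\<lambda>i. (u i)\<^sup>2 + (2 * e) * (u i * r i) + e\<^sup>2 * (r i)\<^sup>2)"
        by (intro E_cong) (simp add: power2_eq_square algebra_simps)
      then show ?thesis by (simp add: E_add E_cmult ur u r2_def)
    qed
    moreover have "Q M (\<lambda>i. u i + e * r i) = Q M u + 2 * e * r2 + e\<^sup>2 * Q M r"
    proof -
      have "Q M (\<lambda>i. u i + e * r i)
          = E (\<lambda>i. u i * app M u i + e * (u i * app M r i) + e * (app M u i * r i) + e\<^sup>2 * (r i * app M r i))"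
        unfolding Q_def app_add app_cmult by (intro E_cong) (simp add: power2_eq_square algebra_simps)
      also have "\<dots> = Q M u + e * E (\<lambda>i. u i * app M r i) + e * r2 + e\<^sup>2 * Q M r"
        by (simp only: E_add E_cmult Q_def Mur)
      also have "E (\<lambda>i. u i * app M r i) = r2" by (simp add: sa Mur)
      finally show ?thesis by simp
    qed
    ultimately show ?thesis by (simp add: algebra_simps)
  qed
  have "r2 = 0"
  proof (rule ccontr)
    assume "r2 \<noteq> 0"
    with r20 have pos: "r2 > 0" by simp
    define b where "b = \<bar>Q M u * r2 - Q M r\<bar> + 1"
    have b: "b > 0" "Q M u * r2 - Q M r < b" by (auto simp: b_def)
    define e where "e = r2 / b"
    have e: "e > 0" using pos b by (simp add: e_def)
    have "e\<^sup>2 * (Q M u * r2 - Q M r) \<le> e\<^sup>2 * b" using b by (intro mult_left_mono) auto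
    also have "\<dots> = e * r2" using b by (simp add: e_def power2_eq_square)
    also have "\<dots> < 2 * e * r2" using e pos by simp
    finally show False using ineq[of e] by simp
  qed
  then have "r i = 0" unfolding r2_def using i by (rule E_square_0)
  then show ?thesis by (simp add: r_def)
qed

text \<open>
  The Perron vector \<open>f\<close> is nonnegative because taking absolute values does not decrease the form of a
  nonnegative kernel. The extremal property of \<open>l + k\<close> is Ky Fan's principle for two
  eigenvalues: an orthonormal pair can be rotated within its plane until one member is orthogonal
  to \<open>f\<close>, and the rotation preserves the sum of the two values of the form.
\<close>

lemma top_two_eigenvectors:
  assumes sym: "\<And>i j. i \<in> I \<Longrightarrow> j \<in> I \<Longrightarrow> M i j = M j i"
    and M0: "\<And>i j. i \<in> I \<Longrightarrow> j \<in> I \<Longrightarrow> 0 \<le> M i j"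
    and uv: "orthonormal u0 v0"
  obtains f g l k where "orthonormal f g" "\<And>i. i \<in> I \<Longrightarrow> 0 \<le> f i"
    "\<And>i. i \<in> I \<Longrightarrow> app M f i = l * f i" "\<And>i. i \<in> I \<Longrightarrow> app M g i = k * g i" "k \<le> l"
    "\<And>u v. orthonormal u v \<Longrightarrow> Q M u + Q M v \<le> l + k" "Q M f = l" "Q M g = k"
proof -
  have u0: "E (\<lambda>i. (u0 i)\<^sup>2) = 1" "E (\<lambda>i. 0 * u0 i) = 0"
    using uv by (simp_all add: orthonormal_def E_const)
  obtain f0 where f0: "E (\<lambda>i. (f0 i)\<^sup>2) = 1"
    and f0_max: "\<And>v. E (\<lambda>i. (v i)\<^sup>2) = 1 \<Longrightarrow> Q M v \<le> Q M f0"
    by (rule maximizer_exists[OF u0, of M]) (simp add: E_const)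
  define f where "f i = \<bar>f0 i\<bar>" for i
  have f1: "E (\<lambda>i. (f i)\<^sup>2) = 1" using f0 by (simp add: f_def)
  have "Q M f0 \<le> Q M f"
    unfolding Q_def app_def E_cmult[symmetric]
  proof (intro E_mono)
    fix i j assume "i \<in> I" "j \<in> I"
    then have "f0 i * (M i j * f0 j) \<le> \<bar>f0 i * (M i j * f0 j)\<bar>" by simp
    also have "\<dots> = f i * (M i j * f j)" using M0[OF \<open>i \<in> I\<close> \<open>j \<in> I\<close>] by (simp add: f_def abs_mult)
    finally show "f0 i * (M i j * f0 j) \<le> f i * (M i j * f j)" .
  qed
  with f0_max have f_max: "Q M v \<le> Q M f" if "E (\<lambda>i. (v i)\<^sup>2) = 1" for v
    using that by (meson order_trans)
  define l where "l = Q M f"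
  have f_eig: "app M f i = l * f i" if "i \<in> I" for i
    unfolding l_def
    by (rule maximizer_eigen[OF sym _ f1 _ _ that, where f = "\<lambda>_. 0" and l = 0])
       (auto simp: f_max app_def E_const)
  have comb: "E (\<lambda>i. (a * u i + b * v i)\<^sup>2) = a\<^sup>2 + b\<^sup>2"
      "E (\<lambda>i. f i * (a * u i + b * v i)) = a * E (\<lambda>i. f i * u i) + b * E (\<lambda>i. f i * v i)"
      "Q M (\<lambda>i. a * u i + b * v i) = a\<^sup>2 * Q M u + b\<^sup>2 * Q M v + 2 * a * b * E (\<lambda>i. u i * app M v i)"
    if "orthonormal u v" for u v a b
  proof -
    have "E (\<lambda>i. (a * u i + b * v i)\<^sup>2) = E (\<lambda>i. a\<^sup>2 * (u i)\<^sup>2 + (2 * a * b) * (u i * v i) + b\<^sup>2 * (v i)\<^sup>2)"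
      by (intro E_cong) (simp add: power2_eq_square algebra_simps)
    then show "E (\<lambda>i. (a * u i + b * v i)\<^sup>2) = a\<^sup>2 + b\<^sup>2"
      using that unfolding orthonormal_def by (simp add: E_add E_cmult)
    show "E (\<lambda>i. f i * (a * u i + b * v i)) = a * E (\<lambda>i. f i * u i) + b * E (\<lambda>i. f i * v i)"
      unfolding E_cmult[symmetric] E_add[symmetric] by (simp add: algebra_simps)
    have "Q M (\<lambda>i. a * u i + b * v i) = E (\<lambda>i. a\<^sup>2 * (u i * app M u i) + b\<^sup>2 * (v i * app M v i)
        + (a * b) * (u i * app M v i) + (a * b) * (v i * app M u i))"
      unfolding Q_def app_add app_cmult by (intro E_cong) (simp add: power2_eq_square algebra_simps)
    also have "\<dots> = a\<^sup>2 * Q M u + b\<^sup>2 * Q M v + (a * b) * E (\<lambda>i. u i * app M v i) + (a * b) * E (\<lambda>i. v i * app M u i)"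
      by (simp only: E_add E_cmult Q_def)
    also have "E (\<lambda>i. v i * app M u i) = E (\<lambda>i. u i * app M v i)"
      using app_self_adjoint[of M v u, OF sym] by (simp add: mult.commute)
    finally show "Q M (\<lambda>i. a * u i + b * v i) = a\<^sup>2 * Q M u + b\<^sup>2 * Q M v + 2 * a * b * E (\<lambda>i. u i * app M v i)"
      by simp
  qed
  have rotate: "\<exists>p q. E (\<lambda>i. (p i)\<^sup>2) = 1 \<and> E (\<lambda>i. (q i)\<^sup>2) = 1 \<and> E (\<lambda>i. f i * p i) = 0
      \<and> Q M p + Q M q = Q M u + Q M v" if o: "orthonormal u v" for u v
  proof -
    define a b where "a = E (\<lambda>i. f i * u i)" and "b = E (\<lambda>i. f i * v i)"
    show ?thesis
    proof (cases "a = 0 \<and> b = 0")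
      case True
      with o show ?thesis unfolding a_def b_def orthonormal_def by blast
    next
      case False
      define s where "s = sqrt (a\<^sup>2 + b\<^sup>2)"
      have s: "s\<^sup>2 = a\<^sup>2 + b\<^sup>2" by (simp add: s_def)
      have s0: "s \<noteq> 0" using False by (simp add: s_def sum_power2_eq_zero_iff)
      define x y where "x = b / s" and "y = - a / s"
      have xy: "x\<^sup>2 + y\<^sup>2 = 1" "y\<^sup>2 + x\<^sup>2 = 1" "x * a + y * b = 0"
      proof -
        have "x\<^sup>2 + y\<^sup>2 = (a\<^sup>2 + b\<^sup>2) / s\<^sup>2" by (simp add: x_def y_def power_divide add_divide_distrib)
        then show "x\<^sup>2 + y\<^sup>2 = 1" using s s0 by (metis divide_self power2_eq_square mult_eq_0_iff)
        then show "y\<^sup>2 + x\<^sup>2 = 1" by simp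
        show "x * a + y * b = 0" by (simp add: x_def y_def)
      qed
      show ?thesis
      proof (intro exI conjI)
        show "E (\<lambda>i. (x * u i + y * v i)\<^sup>2) = 1" "E (\<lambda>i. (- y * u i + x * v i)\<^sup>2) = 1"
          unfolding comb(1)[OF o] using xy by simp_all
        show "E (\<lambda>i. f i * (x * u i + y * v i)) = 0"
          unfolding comb(2)[OF o] using xy by (simp add: a_def b_def)
        have "Q M (\<lambda>i. x * u i + y * v i) + Q M (\<lambda>i. - y * u i + x * v i)
            = (x\<^sup>2 + y\<^sup>2) * (Q M u + Q M v)"
          unfolding comb(3)[OF o] by (simp add: algebra_simps)
        then show "Q M (\<lambda>i. x * u i + y * v i) + Q M (\<lambda>i. - y * u i + x * v i) = Q M u + Q M v"
          by (simp add: xy)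
      qed
    qed
  qed
  from rotate[OF uv] obtain g0 where g0: "E (\<lambda>i. (g0 i)\<^sup>2) = 1" "E (\<lambda>i. f i * g0 i) = 0" by blast
  obtain g where g: "E (\<lambda>i. (g i)\<^sup>2) = 1" "E (\<lambda>i. f i * g i) = 0"
    and g_max: "\<And>v. E (\<lambda>i. (v i)\<^sup>2) = 1 \<Longrightarrow> E (\<lambda>i. f i * v i) = 0 \<Longrightarrow> Q M v \<le> Q M g"
    using maximizer_exists[OF g0, of M] by blast
  show thesis
  proof (rule that[of f g l "Q M g"])
    show "orthonormal f g" using f1 g by (simp add: orthonormal_def)
    show "0 \<le> f i" for i by (simp add: f_def)
    show "app M f i = l * f i" if "i \<in> I" for i by (rule f_eig[OF that])
    show "app M g i = Q M g * g i" if "i \<in> I" for i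
      by (rule maximizer_eigen[OF sym f_eig g g_max that])
    show "Q M g \<le> l" unfolding l_def by (rule f_max[OF g(1)])
    show "Q M u + Q M v \<le> l + Q M g" if o: "orthonormal u v" for u v
    proof -
      from rotate[OF o] obtain p q where
        p: "E (\<lambda>i. (p i)\<^sup>2) = 1" "E (\<lambda>i. f i * p i) = 0" and q: "E (\<lambda>i. (q i)\<^sup>2) = 1"
        and e: "Q M p + Q M q = Q M u + Q M v" by blast
      from g_max[OF p] f_max[OF q] e show ?thesis by (simp add: l_def)
    qed
  qed (simp_all add: l_def)
qed

text \<open>
  Both eigenvectors may be rescaled, and the sign of \<open>g\<close> may be chosen to make its mean nonnegative.
\<close>

lemma eigenvalue_sum_bound_bipartite:
  assumes sym: "\<And>i j. i \<in> I \<Longrightarrow> j \<in> I \<Longrightarrow> N i j = N j i"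
    and N0: "\<And>i j. i \<in> I \<Longrightarrow> j \<in> I \<Longrightarrow> 0 \<le> N i j"
    and N1: "\<And>i j. i \<in> I \<Longrightarrow> j \<in> I \<Longrightarrow> N i j \<le> 1"
    and bip: "\<And>i j. i \<in> I \<Longrightarrow> j \<in> I \<Longrightarrow> N i j \<noteq> 0 \<Longrightarrow> g i * g j < 0"
    and f: "\<And>i. i \<in> I \<Longrightarrow> l * f i = E f - app N f i"
    and g: "\<And>i. i \<in> I \<Longrightarrow> k * g i = E g - app N g i"
    and o: "orthonormal f g" and f0: "\<And>i. i \<in> I \<Longrightarrow> 0 \<le> f i" and kl: "k \<le> l"
  shows "l + k \<le> 8 / 7"
proof -
  have "E f \<noteq> 0"
  proof
    assume "E f = 0"
    from E_nonneg_0[OF f0 this] have "E (\<lambda>i. (f i)\<^sup>2) = E (\<lambda>_. 0)" by (intro E_cong) simp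
    with o show False by (simp add: orthonormal_def E_const)
  qed
  then have Ef: "E f > 0" using E_nonneg[of f] f0 by fastforce
  define s where "s = E (\<lambda>i. \<bar>g i\<bar>)"
  have "s \<noteq> 0"
  proof
    assume "s = 0"
    then have "\<bar>g i\<bar> = 0" if "i \<in> I" for i
      using E_nonneg_0[OF _ _ that, of "\<lambda>i. \<bar>g i\<bar>"] by (simp add: s_def)
    then have "E (\<lambda>i. (g i)\<^sup>2) = E (\<lambda>_. 0)" by (intro E_cong) simp
    with o show False by (simp add: orthonormal_def E_const)
  qed
  moreover have "s \<ge> 0" unfolding s_def by (intro E_nonneg) simp
  ultimately have s: "s > 0" by simp
  define a where "a = 1 / E f"
  define b where "b = (if E g \<ge> 0 then 1 else - 1) / s"
  have a: "a > 0" "a * E f = 1" using Ef by (auto simp: a_def)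
  have b: "b \<noteq> 0" "\<bar>b\<bar> * s = 1" "0 \<le> b * E g" using s by (auto simp: b_def abs_mult divide_nonneg_pos divide_nonpos_pos)
  show ?thesis
  proof (rule eigenvalue_sum_bound_normalized[where N = N and f = "\<lambda>i. a * f i" and g = "\<lambda>i. b * g i"])
    show "N i j = N j i" "0 \<le> N i j" "N i j \<le> 1" if "i \<in> I" "j \<in> I" for i j
      using that by (auto intro: sym N0 N1)
    show "b * g i * (b * g j) < 0" if "i \<in> I" "j \<in> I" "N i j \<noteq> 0" for i j
    proof -
      have "b * g i * (b * g j) = b\<^sup>2 * (g i * g j)" by (simp add: power2_eq_square)
      also have "\<dots> < 0" by (rule mult_pos_neg[OF _ bip[OF that]]) (use b(1) in simp)
      finally show ?thesis .
    qed
    show "l * (a * f i) = E (\<lambda>i. a * f i) - app N (\<lambda>i. a * f i) i" if "i \<in> I" for i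
    proof -
      have "l * (a * f i) = a * (l * f i)" by simp
      also note f[OF that]
      finally show ?thesis by (simp add: E_cmult app_cmult right_diff_distrib)
    qed
    show "k * (b * g i) = E (\<lambda>i. b * g i) - app N (\<lambda>i. b * g i) i" if "i \<in> I" for i
    proof -
      have "k * (b * g i) = b * (k * g i)" by simp
      also note g[OF that]
      finally show ?thesis by (simp add: E_cmult app_cmult right_diff_distrib)
    qed
    have "E (\<lambda>i. a * f i * (b * g i)) = E (\<lambda>i. (a * b) * (f i * g i))" by (intro E_cong) simp
    then show "E (\<lambda>i. a * f i * (b * g i)) = 0" using o by (simp add: E_cmult orthonormal_def)
    show "0 \<le> a * f i" if "i \<in> I" for i using a f0[OF that] by simp
    show "E (\<lambda>i. a * f i) = 1" by (simp add: E_cmult a)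
    show "E (\<lambda>i. \<bar>b * g i\<bar>) = 1" using b by (simp add: abs_mult E_cmult flip: s_def)
    show "0 \<le> E (\<lambda>i. b * g i)" using b by (simp add: E_cmult)
  qed (rule kl)
qed

section \<open>The extremal graph on a finite weighted set\<close>

definition adj :: "('a \<times> 'a) set \<Rightarrow> 'a \<Rightarrow> 'a \<Rightarrow> real" where
  "adj K i j = (if (i, j) \<in> K then 1 else 0)"

lemma Q_adj: "Q (adj K) u + Q (adj K) v = E (\<lambda>i. E (\<lambda>j. adj K i j * (u i * u j + v i * v j)))"
  unfolding Q_def app_def E_cmult[symmetric] E_add[symmetric] by (simp add: algebra_simps)

text \<open>
  Replacing \<open>max 0\<close> by the indicator of the pairs with \<open>u i * u j + v i * v j \<ge> 0\<close> turns the left-hand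
  side into the value of a pair for the form of a graph (loops included), so it is enough to bound the
  sum of the two largest eigenvalues of every graph on \<open>I\<close>. There are finitely many graphs. For an
  optimal one \<open>K\<close>, passing to the graph \<open>K2\<close> of all pairs with \<open>f i * f j + g i * g j \<ge> 0\<close>, where
  \<open>f\<close> and \<open>g\<close> are the eigenvectors of \<open>K\<close>, cannot lower the sum, so \<open>K2\<close> is optimal as well and
  contains \<open>K\<close>. Choosing \<open>K\<close> maximal under inclusion among the optimal graphs thus gives \<open>K = K2\<close>,
  without any problem from pairs where the expression vanishes. As \<open>f \<ge> 0\<close>, every non-edge of
  \<open>K2\<close> joins points where \<open>g\<close> has opposite strict signs.
\<close>

lemma finite_pair_bound:
  assumes uv: "orthonormal u v"
  shows "E (\<lambda>i. E (\<lambda>j. max 0 (u i * u j + v i * v j))) \<le> 8 / 7"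
proof -
  define \<K> where "\<K> = {K. K \<subseteq> I \<times> I \<and> sym K}"
  have fin: "finite \<K>" unfolding \<K>_def by (rule finite_subset[of _ "Pow (I \<times> I)"]) (auto simp: finite_I)
  have adj_sym: "adj K i j = adj K j i" if "K \<in> \<K>" for K i j
    using that by (auto simp: adj_def \<K>_def sym_def)
  define top where "top K f g l k \<longleftrightarrow> orthonormal f g \<and> (\<forall>i\<in>I. 0 \<le> f i) \<and>
    (\<forall>i\<in>I. app (adj K) f i = l * f i) \<and> (\<forall>i\<in>I. app (adj K) g i = k * g i) \<and> k \<le> l \<and>
    (\<forall>u v. orthonormal u v \<longrightarrow> Q (adj K) u + Q (adj K) v \<le> l + k) \<and>
    Q (adj K) f = l \<and> Q (adj K) g = k" for K f g l k
  have "\<exists>f g l k. top K f g l k" if K: "K \<in> \<K>" for K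
  proof -
    show ?thesis
    proof (rule top_two_eigenvectors[where M = "adj K", OF _ _ uv])
      show "adj K i j = adj K j i" "0 \<le> adj K i j" for i j
        by (rule adj_sym[OF K]) (simp add: adj_def)
      fix f g l k
      assume "orthonormal f g" "\<And>i. i \<in> I \<Longrightarrow> 0 \<le> f i"
        "\<And>i. i \<in> I \<Longrightarrow> app (adj K) f i = l * f i" "\<And>i. i \<in> I \<Longrightarrow> app (adj K) g i = k * g i" "k \<le> l"
        "\<And>u v. orthonormal u v \<Longrightarrow> Q (adj K) u + Q (adj K) v \<le> l + k" "Q (adj K) f = l" "Q (adj K) g = k"
      then have "top K f g l k" unfolding top_def by blast
      then show ?thesis by blast
    qed
  qed
  then obtain F G L H where top: "\<And>K. K \<in> \<K> \<Longrightarrow> top K (F K) (G K) (L K) (H K)" by metis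
  define m where "m = Max ((\<lambda>K. L K + H K) ` \<K>)"
  have "{} \<in> \<K>" by (simp add: \<K>_def sym_def)
  then have ne: "\<K> \<noteq> {}" by blast
  have m_max: "L K + H K \<le> m" if "K \<in> \<K>" for K
    unfolding m_def using fin that by (intro Max_ge) auto
  define \<K>' where "\<K>' = {K \<in> \<K>. L K + H K = m}"
  have "m \<in> (\<lambda>K. L K + H K) ` \<K>" unfolding m_def using fin ne by (intro Max_in) auto
  then have "\<K>' \<noteq> {}" by (auto simp: \<K>'_def)
  moreover have "finite \<K>'" using fin by (simp add: \<K>'_def)
  ultimately obtain K where K': "K \<in> \<K>'" and maximal: "\<And>K2. K2 \<in> \<K>' \<Longrightarrow> K \<subseteq> K2 \<Longrightarrow> K = K2"
    using finite_has_maximal[of \<K>'] by blast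
  then have K: "K \<in> \<K>" and Km: "L K + H K = m" by (auto simp: \<K>'_def)
  note topK = top[OF K, unfolded top_def]
  define f g where "f = F K" and "g = G K"
  define p where "p i j = f i * f j + g i * g j" for i j
  define K2 where "K2 = {(i, j). i \<in> I \<and> j \<in> I \<and> 0 \<le> p i j}"
  have K2: "K2 \<in> \<K>" by (auto simp: K2_def \<K>_def sym_def p_def mult.commute)
  have o: "orthonormal f g" using topK by (simp add: f_def g_def)
  have m1: "m = E (\<lambda>i. E (\<lambda>j. adj K i j * p i j))"
    using topK Km by (simp add: p_def f_def g_def flip: Q_adj)
  have m2: "E (\<lambda>i. E (\<lambda>j. adj K2 i j * p i j)) \<le> m"
    using top[OF K2, unfolded top_def] m_max[OF K2] o unfolding p_def Q_adj[symmetric] by fastforce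
  have le: "adj K i j * p i j \<le> adj K2 i j * p i j" if "i \<in> I" "j \<in> I" for i j
    using that by (auto simp: adj_def K2_def)
  have "L K2 + H K2 = m"
  proof -
    have "m \<le> E (\<lambda>i. E (\<lambda>j. adj K2 i j * p i j))" unfolding m1 by (intro E_mono le)
    also have "\<dots> \<le> L K2 + H K2"
      using top[OF K2, unfolded top_def] o unfolding p_def Q_adj[symmetric] by blast
    finally show ?thesis using m_max[OF K2] by simp
  qed
  with K2 have "K2 \<in> \<K>'" by (simp add: \<K>'_def)
  moreover have "K \<subseteq> K2"
  proof (rule subrelI)
    fix i j assume ij: "(i, j) \<in> K"
    then have I: "i \<in> I" "j \<in> I" using K by (auto simp: \<K>_def)
    have "E (\<lambda>i. E (\<lambda>j. adj K2 i j * p i j - adj K i j * p i j)) = 0"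
    proof (rule antisym)
      show "E (\<lambda>i. E (\<lambda>j. adj K2 i j * p i j - adj K i j * p i j)) \<le> 0"
        using m1 m2 by (simp add: E_diff)
      show "0 \<le> E (\<lambda>i. E (\<lambda>j. adj K2 i j * p i j - adj K i j * p i j))"
        by (intro E_nonneg) (simp add: le)
    qed
    then have "E (\<lambda>j. adj K2 i j * p i j - adj K i j * p i j) = 0"
      by (rule E_nonneg_0[rotated, OF _ I(1)]) (intro E_nonneg, simp add: le)
    then have "adj K2 i j * p i j - adj K i j * p i j = 0"
      by (rule E_nonneg_0[rotated, OF _ I(2)]) (simp add: le I)
    then show "(i, j) \<in> K2" using ij I by (auto simp: adj_def K2_def split: if_splits)
  qed
  ultimately have KK2: "K = K2" by (rule maximal)
  define N where "N i j = 1 - adj K i j" for i j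
  have appN: "app N x i = E x - app (adj K) x i" for x i
    unfolding app_def E_diff[symmetric] by (intro E_cong) (simp add: N_def algebra_simps)
  have "L K + H K \<le> 8 / 7"
  proof (rule eigenvalue_sum_bound_bipartite[of N g "L K" f "H K"])
    fix i j assume ij: "i \<in> I" "j \<in> I"
    show "N i j = N j i" by (simp add: N_def adj_sym[OF K, of i])
    show "0 \<le> N i j" "N i j \<le> 1" by (auto simp: N_def adj_def)
    assume "N i j \<noteq> 0"
    then have "f i * f j + g i * g j < 0" using ij KK2 by (auto simp: N_def adj_def K2_def p_def split: if_splits)
    moreover have "0 \<le> f i * f j" using topK ij by (simp add: f_def)
    ultimately show "g i * g j < 0" by linarith
  qed (use topK in \<open>auto simp: appN f_def g_def\<close>)
  then have m87: "m \<le> 8 / 7" using Km by simp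
  define K3 where "K3 = {(i, j). i \<in> I \<and> j \<in> I \<and> 0 \<le> u i * u j + v i * v j}"
  have K3: "K3 \<in> \<K>" by (auto simp: K3_def \<K>_def sym_def mult.commute)
  have "E (\<lambda>i. E (\<lambda>j. max 0 (u i * u j + v i * v j))) = E (\<lambda>i. E (\<lambda>j. adj K3 i j * (u i * u j + v i * v j)))"
    by (intro E_cong) (auto simp: adj_def K3_def)
  also have "\<dots> \<le> L K3 + H K3" unfolding Q_adj[symmetric]
    using top[OF K3, unfolded top_def] uv by blast
  also have "\<dots> \<le> m" by (rule m_max[OF K3])
  finally show ?thesis using m87 by simp
qed

end

section \<open>The graphon operator and step functions\<close>

lemma L2_eq_imp_abs_eq: "L2_eq f g \<Longrightarrow> abs_L2 f = abs_L2 g"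
  using Quotient3_rel[OF Quotient3_L2] by (metis L2_eq_def L2_eq_refl)

lemma L2_cases:
  obtains f where "square_integrable f" "h = abs_L2 f"
  by (metis Quotient3_L2 Quotient3_abs_rep Quotient3_rep_reflp L2_eq_refl)

lemma abs_L2_add: "square_integrable f \<Longrightarrow> square_integrable g \<Longrightarrow>
    abs_L2 f + abs_L2 g = abs_L2 (\<lambda>x. f x + g x)"
  by (rule plus_L2.abs_eq) (simp_all add: L2_eq_refl)

lemma abs_L2_scaleR: "square_integrable f \<Longrightarrow> c *\<^sub>R abs_L2 f = abs_L2 (\<lambda>x. c * f x)"
  by (rule scaleR_L2.abs_eq) (simp_all add: L2_eq_refl)

lemma abs_L2_zero: "abs_L2 (\<lambda>x. 0) = 0"
  by (simp add: zero_L2_def)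

lemma abs_L2_diff:
  assumes "square_integrable f" "square_integrable g"
  shows "abs_L2 f - abs_L2 g = abs_L2 (\<lambda>x. f x - g x)"
proof -
  have "abs_L2 f - abs_L2 g = abs_L2 f + (-1) *\<^sub>R abs_L2 g" by simp
  also have "(-1) *\<^sub>R abs_L2 g = abs_L2 (\<lambda>x. -1 * g x)" by (rule abs_L2_scaleR[OF assms(2)])
  also have "abs_L2 f + abs_L2 (\<lambda>x. -1 * g x) = abs_L2 (\<lambda>x. f x + -1 * g x)"
    by (rule abs_L2_add[OF assms(1) square_integrable_scale[OF assms(2)]])
  finally show ?thesis by simp
qed

lemma inner_abs_L2: "square_integrable f \<Longrightarrow> square_integrable g \<Longrightarrow>
    inner (abs_L2 f) (abs_L2 g) = (LINT x|leb01. f x * g x)"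
  by (rule inner_L2.abs_eq) (simp_all add: L2_eq_refl)

lemma norm_abs_L2: "square_integrable f \<Longrightarrow> (norm (abs_L2 f))\<^sup>2 = (LINT x|leb01. (f x)\<^sup>2)"
  by (simp add: power2_norm_eq_inner inner_abs_L2) (simp add: power2_eq_square)

lemma square_integrable_sum:
  assumes "finite I" "\<And>i. i \<in> I \<Longrightarrow> square_integrable (f i)"
  shows "square_integrable (\<lambda>x. \<Sum>i\<in>I. f i x)"
    and "(\<Sum>i\<in>I. abs_L2 (f i)) = abs_L2 (\<lambda>x. \<Sum>i\<in>I. f i x)"
proof -
  have "square_integrable (\<lambda>x. \<Sum>i\<in>I. f i x) \<and> (\<Sum>i\<in>I. abs_L2 (f i)) = abs_L2 (\<lambda>x. \<Sum>i\<in>I. f i x)"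
    using assms
    by (induction I rule: finite_induct)
       (auto simp: square_integrable_zero abs_L2_zero square_integrable_add abs_L2_add)
  then show "square_integrable (\<lambda>x. \<Sum>i\<in>I. f i x)"
    and "(\<Sum>i\<in>I. abs_L2 (f i)) = abs_L2 (\<lambda>x. \<Sum>i\<in>I. f i x)" by auto
qed

lemma measure_leb01_space: "measure leb01 {0..1} = 1"
  by (subst measure_restrict_space) auto

lemma finite_measure_leb01: "finite_measure leb01"
  by (rule finite_measure_lebesgue_on) simp

lemma square_integrable_indicator:
  assumes "A \<in> sets leb01"
  shows "square_integrable (indicator A)"
  unfolding square_integrable_def
proof
  show m: "indicator A \<in> borel_measurable leb01" using assms by simp
  have "(\<lambda>x. (indicator A x :: real)\<^sup>2) = indicator A" by (auto simp: indicator_def)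
  moreover have "integrable leb01 (indicator A :: real \<Rightarrow> real)"
    by (rule finite_measure.integrable_const_bound[OF finite_measure_leb01 _ m, of 1]) simp
  ultimately show "integrable leb01 (\<lambda>x. (indicator A x :: real)\<^sup>2)" by simp
qed

text \<open>
  Cauchy-Schwarz against the constant function, the measure being a probability measure.
\<close>

lemma integral_abs_le_norm:
  assumes "square_integrable f"
  shows "(LINT x|leb01. \<bar>f x\<bar>) \<le> norm (abs_L2 f)"
proof -
  have a: "square_integrable (\<lambda>x. \<bar>f x\<bar>)" using assms by (auto simp: square_integrable_def)
  have o: "square_integrable (\<lambda>x. 1)" by (simp add: square_integrable_def integrable_const_leb01)
  have "(norm (abs_L2 (\<lambda>x. 1)))\<^sup>2 = 1"
    unfolding norm_abs_L2[OF o] using measure_leb01_space by simp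
  then have n1: "norm (abs_L2 (\<lambda>x. 1)) = 1" 
    by (metis norm_ge_zero power2_eq_iff_nonneg power_one zero_le_one)
  have "(norm (abs_L2 (\<lambda>x. \<bar>f x\<bar>)))\<^sup>2 = (norm (abs_L2 f))\<^sup>2"
    by (simp add: norm_abs_L2 a assms)
  then have "norm (abs_L2 (\<lambda>x. \<bar>f x\<bar>)) = norm (abs_L2 f)" by (simp add: power2_eq_iff_nonneg)
  moreover have "inner (abs_L2 (\<lambda>x. \<bar>f x\<bar>)) (abs_L2 (\<lambda>x. 1)) = (LINT x|leb01. \<bar>f x\<bar>)"
    by (simp add: inner_abs_L2[OF a o])
  ultimately show ?thesis
    using norm_cauchy_schwarz[of "abs_L2 (\<lambda>x. \<bar>f x\<bar>)" "abs_L2 (\<lambda>x. 1)"] n1 by simp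
qed

text \<open>
  Off a null set \<open>K\<close> agrees with a Borel function, whose sections are all measurable. Linearity of
  the operator depends on this: where a section of \<open>K\<close> is not measurable, an integral may have
  the default value \<open>0\<close>.
\<close>

lemma graphon_section_measurable:
  assumes K: "graphon K"
  shows "AE x in leb01. (\<lambda>y. K (x, y)) \<in> borel_measurable leb01"
proof -
  define S :: "(real \<times> real) set" where "S = {0..1} \<times> {0..1}"
  have S: "S \<in> sets lebesgue"
    unfolding S_def by (intro sets_completionI_sets) (simp add: borel_Times)
  define K0 where "K0 p = indicator S p * K p" for p
  have "K0 \<in> borel_measurable (completion lborel)"
    using K S borel_measurable_restrict_space_iff[of S lebesgue K]
    by (simp add: graphon_def K0_def[abs_def] S_def)
  from completion_ex_borel_measurable_real[OF this]
  obtain K1 where K1: "K1 \<in> borel_measurable lborel" and K1_eq: "AE p in lborel. K0 p = K1 p"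
    by blast
  have "AE p in lborel \<Otimes>\<^sub>M lborel. K0 p = K1 p"
    using K1_eq unfolding lborel_prod .
  from lborel_pair.AE_pair[OF this] have sect: "AE x in lborel. AE y in lborel. K0 (x, y) = K1 (x, y)"
    by simp
  have "(\<lambda>y. K (x, y)) \<in> borel_measurable leb01"
    if x: "x \<in> {0..1}" and ae: "AE y in lborel. K0 (x, y) = K1 (x, y)" for x
  proof -
    have "(\<lambda>y. K1 (x, y)) \<in> borel_measurable lborel" using K1 by measurable
    then have K1x: "(\<lambda>y. K1 (x, y)) \<in> borel_measurable lebesgue" by (rule measurable_completion)
    have "AE y in lebesgue. K1 (x, y) = K0 (x, y)"
      using AE_completion[OF ae] by eventually_elim simp
    with K1x have "(\<lambda>y. K0 (x, y)) \<in> borel_measurable lebesgue" by (rule borel_measurable_AE)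
    moreover have "(\<lambda>y. K0 (x, y)) = (\<lambda>y. indicator {0..1} y * K (x, y))"
      using x by (auto simp: K0_def S_def indicator_def)
    ultimately show ?thesis by (simp add: borel_measurable_leb01_iff)
  qed
  then have "AE x in lebesgue. x \<in> {0..1} \<longrightarrow> (\<lambda>y. K (x, y)) \<in> borel_measurable leb01"
    using AE_completion[OF sect] by (auto elim: AE_mp)
  then show ?thesis by (subst AE_restrict_space_iff) auto
qed

lemma kernel_integral_bound:
  assumes K: "graphon K" and h: "square_integrable h" and x: "x \<in> {0..1}"
  shows "\<bar>kernel_integral K h x\<bar> \<le> (LINT y|leb01. \<bar>h y\<bar>)"
proof -
  have "\<bar>kernel_integral K h x\<bar> \<le> (LINT y|leb01. \<bar>K (x, y) * h y\<bar>)"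
    unfolding kernel_integral_def by (rule integral_abs_bound)
  also have "\<dots> \<le> (LINT y|leb01. \<bar>h y\<bar>)"
  proof (rule integral_mono_AE')
    show "integrable leb01 (\<lambda>y. \<bar>h y\<bar>)"
      using square_integrable_imp_integrable[OF h] by simp
    show "AE y in leb01. \<bar>K (x, y) * h y\<bar> \<le> \<bar>h y\<bar>"
      using x K by (intro AE_I2) (auto simp: graphon_def abs_mult intro!: mult_left_le_one_le)
  qed simp
  finally show ?thesis .
qed

lemma kernel_integral_add:
  assumes K: "graphon K" and f: "square_integrable f" and g: "square_integrable g"
  shows "AE x in leb01. kernel_integral K (\<lambda>y. f y + g y) x = kernel_integral K f x + kernel_integral K g x"
proof -
  have int: "integrable leb01 (\<lambda>y. K (x, y) * h y)"
    if h: "square_integrable h" and x: "x \<in> {0..1}" and m: "(\<lambda>y. K (x, y)) \<in> borel_measurable leb01" for h x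
  proof (rule Bochner_Integration.integrable_bound)
    show "integrable leb01 h" by (rule square_integrable_imp_integrable[OF h])
    show "(\<lambda>y. K (x, y) * h y) \<in> borel_measurable leb01"
      using m h by (auto simp: square_integrable_def)
    show "AE y in leb01. norm (K (x, y) * h y) \<le> norm (h y)"
      using x K by (intro AE_I2) (auto simp: graphon_def abs_mult intro!: mult_left_le_one_le)
  qed
  have "AE x in leb01. x \<in> space leb01" by (rule AE_space)
  with graphon_section_measurable[OF K] show ?thesis
  proof eventually_elim
    case (elim x)
    then have x: "x \<in> {0..1}" by simp
    show ?case unfolding kernel_integral_def
      using int[OF f x elim(1)] int[OF g x elim(1)] by (simp add: distrib_left)
  qed
qed

lemma bounded_linear_graphon_op:
  assumes K: "graphon K"
  shows "bounded_linear (graphon_op K)" and "norm (graphon_op K h) \<le> norm h"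
proof -
  have norm: "norm (graphon_op K h) \<le> norm h" for h
  proof -
    obtain f where f: "square_integrable f" and h: "h = abs_L2 f" by (rule L2_cases)
    define c where "c = (LINT y|leb01. \<bar>f y\<bar>)"
    have c0: "c \<ge> 0" unfolding c_def by (rule integral_nonneg_AE) simp
    have k: "square_integrable (kernel_integral K f)" by (rule square_integrable_kernel_integral[OF K f])
    have "(norm (graphon_op K h))\<^sup>2 = (LINT x|leb01. (kernel_integral K f x)\<^sup>2)"
      by (simp add: h graphon_op_abs[OF f] norm_abs_L2[OF k])
    also have "\<dots> \<le> (LINT x|leb01. c\<^sup>2)"
    proof (rule integral_mono_AE)
      show "AE x in leb01. (kernel_integral K f x)\<^sup>2 \<le> c\<^sup>2"
        using kernel_integral_bound[OF K f] c0
        by (intro AE_I2) (auto simp: c_def abs_le_square_iff[symmetric])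
    qed (use k in \<open>auto simp: square_integrable_def integrable_const_leb01\<close>)
    also have "\<dots> = c\<^sup>2" using measure_leb01_space by simp
    finally have "norm (graphon_op K h) \<le> c" using c0 by (rule power2_le_imp_le)
    also have "c \<le> norm h" unfolding c_def h by (rule integral_abs_le_norm[OF f])
    finally show ?thesis .
  qed
  show "bounded_linear (graphon_op K)"
  proof (rule bounded_linear_intro[of _ 1])
    fix h1 h2 :: L2
    obtain f where f: "square_integrable f" and h1: "h1 = abs_L2 f" by (rule L2_cases)
    obtain g where g: "square_integrable g" and h2: "h2 = abs_L2 g" by (rule L2_cases)
    note k = square_integrable_kernel_integral[OF K]
    have "graphon_op K (h1 + h2) = abs_L2 (kernel_integral K (\<lambda>x. f x + g x))"
      unfolding h1 h2 abs_L2_add[OF f g] by (rule graphon_op_abs[OF square_integrable_add[OF f g]])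
    also have "\<dots> = abs_L2 (\<lambda>x. kernel_integral K f x + kernel_integral K g x)"
      by (rule L2_eq_imp_abs_eq)
         (auto simp: L2_eq_def intro!: k square_integrable_add f g kernel_integral_add K)
    also have "\<dots> = graphon_op K h1 + graphon_op K h2"
      by (simp add: h1 h2 graphon_op_abs f g abs_L2_add k)
    finally show "graphon_op K (h1 + h2) = graphon_op K h1 + graphon_op K h2" .
    show "graphon_op K (c *\<^sub>R h1) = c *\<^sub>R graphon_op K h1" for c
    proof -
      have "kernel_integral K (\<lambda>x. c * f x) = (\<lambda>x. c * kernel_integral K f x)"
        unfolding kernel_integral_def by (simp add: mult.left_commute)
      then show ?thesis
        by (simp add: h1 abs_L2_scaleR f k graphon_op_abs square_integrable_scale)
    qed
    show "norm (graphon_op K h1) \<le> norm h1 * 1" using norm by simp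
  qed
  show "norm (graphon_op K h) \<le> norm h" by (rule norm)
qed

definition step_ind :: "real set \<Rightarrow> L2" where
  "step_ind A = abs_L2 (indicator A)"

lemma inner_step_ind:
  assumes "A \<in> sets leb01" "B \<in> sets leb01"
  shows "inner (step_ind A) (step_ind B) = measure leb01 (A \<inter> B)"
proof -
  have "inner (step_ind A) (step_ind B) = (LINT x|leb01. indicator (A \<inter> B) x)"
    unfolding step_ind_def using assms
    by (simp add: inner_abs_L2 square_integrable_indicator indicator_inter_arith)
  then show ?thesis using assms sets.sets_into_space[of A leb01] by (simp add: Int_absorb2 inf.absorb1 inf.coboundedI1)
qed

lemma inner_graphon_op_step_ind:
  assumes K: "graphon K" and A: "A \<in> sets leb01" and B: "B \<in> sets leb01"
  shows "0 \<le> inner (step_ind A) (graphon_op K (step_ind B))"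
    and "inner (step_ind A) (graphon_op K (step_ind B)) \<le> measure leb01 A * measure leb01 B"
proof -
  note iA = square_integrable_indicator[OF A] and iB = square_integrable_indicator[OF B]
  have k: "square_integrable (kernel_integral K (indicator B))"
    by (rule square_integrable_kernel_integral[OF K iB])
  have e: "inner (step_ind A) (graphon_op K (step_ind B)) = (LINT x|leb01. indicator A x * kernel_integral K (indicator B) x)"
    unfolding step_ind_def by (simp add: graphon_op_abs iA iB inner_abs_L2 k)
  have k0: "0 \<le> kernel_integral K (indicator B) x" if "x \<in> {0..1}" for x
    unfolding kernel_integral_def using K that
    by (intro integral_nonneg_AE AE_I2) (auto simp: graphon_def)
  have mB: "(LINT y|leb01. \<bar>indicator B y\<bar>) = measure leb01 B"
    using sets.sets_into_space[OF B] by (simp add: inf.absorb1 B)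
  have k1: "kernel_integral K (indicator B) x \<le> measure leb01 B" if "x \<in> {0..1}" for x
    using kernel_integral_bound[OF K iB that] mB by simp
  show "0 \<le> inner (step_ind A) (graphon_op K (step_ind B))"
    unfolding e by (intro integral_nonneg_AE AE_I2) (auto intro!: mult_nonneg_nonneg k0)
  have "(LINT x|leb01. indicator A x * kernel_integral K (indicator B) x)
      \<le> (LINT x|leb01. indicator A x * measure leb01 B)"
  proof (rule integral_mono_AE)
    show "integrable leb01 (\<lambda>x. indicator A x * kernel_integral K (indicator B) x)"
      by (rule square_integrable_mult[OF iA k])
    show "integrable leb01 (\<lambda>x. indicator A x * measure leb01 B)"
      using square_integrable_imp_integrable[OF iA] by simp
    show "AE x in leb01. indicator A x * kernel_integral K (indicator B) x \<le> indicator A x * measure leb01 B"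
      by (intro AE_I2 mult_left_mono k1) auto
  qed
  also have "\<dots> = measure leb01 A * measure leb01 B"
    using sets.sets_into_space[OF A] by (simp add: inf.absorb1 A)
  finally show "inner (step_ind A) (graphon_op K (step_ind B)) \<le> measure leb01 A * measure leb01 B"
    unfolding e .
qed

text \<open>
  The set is needed for two functions and one common partition at a time, so the partition is a
  parameter; fixing it makes the set a subspace.
\<close>

definition steps :: "'i set \<Rightarrow> ('i \<Rightarrow> real set) \<Rightarrow> L2 set" where
  "steps I A = {u. \<exists>a. u = (\<Sum>i\<in>I. a i *\<^sub>R step_ind (A i))}"

lemma subspace_steps: "subspace (steps I A)"
proof (rule subspaceI)
  show "0 \<in> steps I A" unfolding steps_def by (simp add: exI[of _ "\<lambda>_. 0"])
  show "x + y \<in> steps I A" if xy: "x \<in> steps I A" "y \<in> steps I A" for x y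
  proof -
    obtain a b where "x = (\<Sum>i\<in>I. a i *\<^sub>R step_ind (A i))" "y = (\<Sum>i\<in>I. b i *\<^sub>R step_ind (A i))"
      using xy by (auto simp: steps_def)
    then have "x + y = (\<Sum>i\<in>I. (a i + b i) *\<^sub>R step_ind (A i))"
      by (simp add: scaleR_add_left sum.distrib)
    then show ?thesis unfolding steps_def by (intro CollectI exI[of _ "\<lambda>i. a i + b i"])
  qed
  show "c *\<^sub>R x \<in> steps I A" if x: "x \<in> steps I A" for c x
  proof -
    obtain a where "x = (\<Sum>i\<in>I. a i *\<^sub>R step_ind (A i))" using x by (auto simp: steps_def)
    then have "c *\<^sub>R x = (\<Sum>i\<in>I. (c * a i) *\<^sub>R step_ind (A i))" by (simp add: scaleR_sum_right)
    then show ?thesis unfolding steps_def by (intro CollectI exI[of _ "\<lambda>i. c * a i"])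
  qed
qed

definition partition01 :: "'i set \<Rightarrow> ('i \<Rightarrow> real set) \<Rightarrow> bool" where
  "partition01 I A \<longleftrightarrow> finite I \<and> (\<forall>i\<in>I. A i \<in> sets leb01) \<and> disjoint_family_on A I \<and> (\<Union>i\<in>I. A i) = {0..1}"

lemma simple_approximation:
  assumes f: "square_integrable f"
  obtains F where "\<And>n. simple_function leb01 (F n)" "\<And>n. square_integrable (F n)"
    "(\<lambda>n. abs_L2 (F n)) \<longlonglongrightarrow> abs_L2 f"
proof -
  have fm: "f \<in> borel_measurable leb01" using f by (simp add: square_integrable_def)
  obtain F where F': "\<forall>n. simple_function leb01 (F n)"
    "\<forall>x\<in>space leb01. (\<lambda>n. F n x) \<longlonglongrightarrow> f x"
    "\<forall>n. \<forall>x\<in>space leb01. dist (F n x) 0 \<le> 2 * dist (f x) 0"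
    using borel_measurable_implies_sequence_metric[OF fm, of 0] by blast
  then have F: "simple_function leb01 (F n)"
    "x \<in> space leb01 \<Longrightarrow> (\<lambda>n. F n x) \<longlonglongrightarrow> f x"
    "x \<in> space leb01 \<Longrightarrow> \<bar>F n x\<bar> \<le> 2 * \<bar>f x\<bar>" for n x
    by auto
  have Fm: "F n \<in> borel_measurable leb01" for n by (rule borel_measurable_simple_function[OF F(1)])
  have f2: "integrable leb01 (\<lambda>x. 4 * (f x)\<^sup>2)" "integrable leb01 (\<lambda>x. 9 * (f x)\<^sup>2)"
    using f by (simp_all add: square_integrable_def)
  have sq: "square_integrable (F n)" for n
    unfolding square_integrable_def
  proof
    show "integrable leb01 (\<lambda>x. (F n x)\<^sup>2)"
    proof (rule Bochner_Integration.integrable_bound[OF f2(1)])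
      have "(F n x)\<^sup>2 \<le> 4 * (f x)\<^sup>2" if "x \<in> space leb01" for x
        using power_mono[OF F(3)[OF that, of n], of 2] by (simp add: power_mult_distrib)
      then show "AE x in leb01. norm ((F n x)\<^sup>2) \<le> norm (4 * (f x)\<^sup>2)"
        by (intro AE_I2) simp
    qed (use Fm in measurable)
  qed (rule Fm)
  have lim: "(\<lambda>n. LINT x|leb01. (F n x - f x)\<^sup>2) \<longlonglongrightarrow> (LINT x|leb01. 0)"
  proof (rule integral_dominated_convergence[OF _ _ f2(2)])
    show "AE x in leb01. (\<lambda>n. (F n x - f x)\<^sup>2) \<longlonglongrightarrow> 0"
    proof (rule AE_I2)
      fix x assume "x \<in> space leb01"
      from tendsto_power[OF tendsto_diff[OF F(2)[OF this] tendsto_const[of "f x"]], of 2]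
      show "(\<lambda>n. (F n x - f x)\<^sup>2) \<longlonglongrightarrow> 0" by simp
    qed
    show "AE x in leb01. norm ((F n x - f x)\<^sup>2) \<le> 9 * (f x)\<^sup>2" for n
    proof (rule AE_I2)
      fix x assume x: "x \<in> space leb01"
      have "\<bar>F n x - f x\<bar> \<le> 3 * \<bar>f x\<bar>" using F(3)[OF x, of n] by linarith
      from power_mono[OF this, of 2] show "norm ((F n x - f x)\<^sup>2) \<le> 9 * (f x)\<^sup>2"
        by (simp add: power_mult_distrib)
    qed
  qed (use Fm fm in measurable)
  have "(norm (abs_L2 (F n) - abs_L2 f))\<^sup>2 = (LINT x|leb01. (F n x - f x)\<^sup>2)" for n
  proof -
    have "square_integrable (\<lambda>x. F n x - f x)"
      using square_integrable_add[OF sq square_integrable_uminus[OF f]] by simp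
    then show ?thesis by (simp add: abs_L2_diff sq f norm_abs_L2)
  qed
  with lim have "(\<lambda>n. (norm (abs_L2 (F n) - abs_L2 f))\<^sup>2) \<longlonglongrightarrow> 0" by simp
  from tendsto_real_sqrt[OF this] have "(\<lambda>n. norm (abs_L2 (F n) - abs_L2 f)) \<longlonglongrightarrow> 0" by simp
  then have "(\<lambda>n. abs_L2 (F n)) \<longlonglongrightarrow> abs_L2 f"
    by (simp add: LIM_zero_cancel tendsto_norm_zero_iff)
  with F(1) sq show thesis by (rule that)
qed

lemma simple_in_steps:
  fixes I :: "(real \<times> real) set"
  assumes F: "simple_function leb01 F" and G: "simple_function leb01 G"
  defines "I \<equiv> F ` {0..1} \<times> G ` {0..1}" and "A \<equiv> \<lambda>p. {x \<in> {0..1}. F x = fst p \<and> G x = snd p}"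
  assumes sF: "square_integrable F" and sG: "square_integrable G"
  shows "partition01 I A" "abs_L2 F \<in> steps I A" "abs_L2 G \<in> steps I A"
proof -
  have sp: "space leb01 = {0..1}" by simp
  have fin: "finite I" using F G unfolding I_def simple_function_def sp by simp
  have FG: "F \<in> borel_measurable leb01" "G \<in> borel_measurable leb01"
    using F G by (auto intro: borel_measurable_simple_function)
  have A: "A p \<in> sets leb01" for p
  proof -
    have "{x \<in> space leb01. F x = fst p \<and> G x = snd p} \<in> sets leb01"
      using FG by measurable
    then show ?thesis by (simp add: A_def)
  qed
  show part: "partition01 I A"
    using fin A by (auto simp: partition01_def disjoint_family_on_def A_def I_def)
  have "abs_L2 H \<in> steps I A"
    if H: "square_integrable H" and c: "\<And>x. x \<in> {0..1} \<Longrightarrow> H x = c (F x, G x)" for H c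
  proof -
    have si: "square_integrable (\<lambda>x. c p * indicator (A p) x)" for p
      by (intro square_integrable_scale square_integrable_indicator A)
    have "(\<Sum>p\<in>I. c p *\<^sub>R step_ind (A p)) = (\<Sum>p\<in>I. abs_L2 (\<lambda>x. c p * indicator (A p) x))"
      by (intro sum.cong refl) (simp add: step_ind_def abs_L2_scaleR square_integrable_indicator A)
    also have "\<dots> = abs_L2 (\<lambda>x. \<Sum>p\<in>I. c p * indicator (A p) x)"
      by (rule square_integrable_sum(2)[OF fin si])
    also have "\<dots> = abs_L2 H"
    proof (rule L2_eq_imp_abs_eq)
      have "(\<Sum>p\<in>I. c p * indicator (A p) x) = H x" if x: "x \<in> {0..1}" for x
      proof -
        have "(\<Sum>p\<in>I. c p * indicator (A p) x) = (\<Sum>p\<in>I. if p = (F x, G x) then c p else 0)"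
          using x by (intro sum.cong refl) (auto simp: A_def indicator_def)
        also have "\<dots> = c (F x, G x)" using x fin by (simp add: I_def)
        finally show ?thesis by (simp add: c[OF x])
      qed
      then show "L2_eq (\<lambda>x. \<Sum>p\<in>I. c p * indicator (A p) x) H"
        unfolding L2_eq_def using square_integrable_sum(1)[OF fin si] H by auto
    qed
    finally show ?thesis unfolding steps_def by (intro CollectI exI[of _ c]) (rule sym)
  qed
  from this[OF sF, of fst] this[OF sG, of snd] show "abs_L2 F \<in> steps I A" "abs_L2 G \<in> steps I A"
    by simp_all
qed


section \<open>The spectral sum of a graphon\<close>

text \<open>
  For step functions the two forms are a combination of the masses of \<open>K\<close> on the cells
  \<open>A i \<times> A j\<close>. Such a mass lies between \<open>0\<close> and \<open>w i * w j\<close>, so the combination is largest when \<open>K\<close>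
  is \<open>1\<close> on the cells with a positive coefficient and \<open>0\<close> on the others.
\<close>

lemma step_bound:
  assumes K: "graphon K" and part: "partition01 I A"
    and u: "u \<in> steps I A" "norm u = 1" and v: "v \<in> steps I A" "norm v = 1" and uv: "inner u v = 0"
  shows "inner u (graphon_op K u) + inner v (graphon_op K v) \<le> 8 / 7"
proof -
  define w where "w i = measure leb01 (A i)" for i
  \<comment> \<open>cells of measure zero represent the zero vector and are dropped, as weights must be positive\<close>
  define J where "J = {i \<in> I. w i \<noteq> 0}"
  define e where "e i = step_ind (A i)" for i
  have fin: "finite I" and A: "\<And>i. i \<in> I \<Longrightarrow> A i \<in> sets leb01" and disj: "disjoint_family_on A I"
    and union: "(\<Union>i\<in>I. A i) = {0..1}" using part by (auto simp: partition01_def)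
  have finJ: "finite J" and JI: "J \<subseteq> I" using fin by (auto simp: J_def)
  have ee: "inner (e i) (e j) = (if i = j then w i else 0)" if "i \<in> I" "j \<in> I" for i j
    using that disj by (auto simp: e_def inner_step_ind A w_def disjoint_family_on_def)
  have e0: "e i = 0" if "i \<in> I" "w i = 0" for i
    using ee[OF that(1) that(1)] that(2) by simp
  have sumJ: "(\<Sum>i\<in>I. c i *\<^sub>R e i) = (\<Sum>i\<in>J. c i *\<^sub>R e i)" for c
    using fin JI by (intro sum.mono_neutral_right) (auto simp: J_def e0)
  obtain a where a: "u = (\<Sum>i\<in>J. a i *\<^sub>R e i)"
    using u(1) unfolding steps_def e_def[symmetric] sumJ by auto
  obtain b where b: "v = (\<Sum>i\<in>J. b i *\<^sub>R e i)"
    using v(1) unfolding steps_def e_def[symmetric] sumJ by auto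
  have "sum w I = measure leb01 (\<Union>i\<in>I. A i)"
    unfolding w_def
    by (rule finite_measure.finite_measure_finite_Union[OF finite_measure_leb01 fin _ disj, symmetric])
       (use A in auto)
  then have "sum w I = 1" by (simp add: union measure_leb01_space)
  moreover have "sum w I = sum w J" using fin JI by (intro sum.mono_neutral_right) (auto simp: J_def)
  ultimately interpret weighted_set J w
    using finJ by unfold_locales (auto simp: J_def w_def order.strict_iff_order)
  have inner_E: "inner (\<Sum>i\<in>J. c i *\<^sub>R e i) (\<Sum>i\<in>J. d i *\<^sub>R e i) = E (\<lambda>i. c i * d i)" for c d
  proof -
    have "inner (\<Sum>i\<in>J. c i *\<^sub>R e i) (\<Sum>i\<in>J. d i *\<^sub>R e i) = (\<Sum>i\<in>J. \<Sum>j\<in>J. c i * (d j * inner (e i) (e j)))"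
      by (simp add: inner_sum_left) (simp add: inner_sum_right sum_distrib_left)
    also have "\<dots> = (\<Sum>i\<in>J. \<Sum>j\<in>J. if j = i then w i * (c i * d i) else 0)"
      using JI by (intro sum.cong refl) (auto simp: ee subset_iff)
    also have "\<dots> = E (\<lambda>i. c i * d i)" using finJ by (simp add: E_def)
    finally show ?thesis .
  qed
  have o: "orthonormal a b"
    using u(2) v(2) uv by (simp add: orthonormal_def a b norm_eq_1 inner_E power2_eq_square)
  define k where "k i j = inner (e i) (graphon_op K (e j))" for i j
  have lin: "linear (graphon_op K)" using bounded_linear_graphon_op(1)[OF K] by (rule bounded_linear.linear)
  have form: "inner (\<Sum>i\<in>J. c i *\<^sub>R e i) (graphon_op K (\<Sum>i\<in>J. c i *\<^sub>R e i)) = (\<Sum>i\<in>J. \<Sum>j\<in>J. c i * c j * k i j)" for c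
    by (simp add: linear_sum[OF lin] linear_scale[OF lin] inner_sum_left)
       (simp add: inner_sum_right sum_distrib_left k_def mult.assoc)
  have "inner u (graphon_op K u) + inner v (graphon_op K v) = (\<Sum>i\<in>J. \<Sum>j\<in>J. (a i * a j + b i * b j) * k i j)"
    unfolding a b form by (simp add: sum.distrib distrib_right)
  also have "\<dots> \<le> (\<Sum>i\<in>J. \<Sum>j\<in>J. w i * (w j * max 0 (a i * a j + b i * b j)))"
  proof (intro sum_mono)
    fix i j assume "i \<in> J" "j \<in> J"
    then have ij: "A i \<in> sets leb01" "A j \<in> sets leb01" using A JI by auto
    have k: "0 \<le> k i j" "k i j \<le> w i * w j"
      using inner_graphon_op_step_ind[OF K ij] by (auto simp: k_def e_def w_def)
    have "(a i * a j + b i * b j) * k i j \<le> max 0 (a i * a j + b i * b j) * k i j"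
      using k by (intro mult_right_mono) auto
    also have "\<dots> \<le> max 0 (a i * a j + b i * b j) * (w i * w j)"
      using k by (intro mult_left_mono) auto
    finally show "(a i * a j + b i * b j) * k i j \<le> w i * (w j * max 0 (a i * a j + b i * b j))"
      by (simp add: mult_ac)
  qed
  also have "\<dots> = E (\<lambda>i. E (\<lambda>j. max 0 (a i * a j + b i * b j)))"
    by (simp add: E_def sum_distrib_left)
  also have "\<dots> \<le> 8 / 7" by (rule finite_pair_bound[OF o])
  finally show ?thesis .
qed

text \<open>
  Simultaneous approximation by step functions destroys orthonormality. Gram-Schmidt restores it
  inside the span, hence for the same partition, and does not change the limits.
\<close>

lemma orthonormal_pair_bound:
  assumes K: "graphon K" and f: "norm f = 1" and g: "norm g = 1" and fg: "inner f g = 0"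
  shows "inner f (graphon_op K f) + inner g (graphon_op K g) \<le> 8 / 7"
proof -
  obtain f0 g0 where f0: "square_integrable f0" "f = abs_L2 f0" and g0: "square_integrable g0" "g = abs_L2 g0"
    by (metis L2_cases)
  obtain F where F: "\<And>n. simple_function leb01 (F n)" "\<And>n. square_integrable (F n)" "(\<lambda>n. abs_L2 (F n)) \<longlonglongrightarrow> f"
    using simple_approximation[OF f0(1)] unfolding f0(2) by blast
  obtain G where G: "\<And>n. simple_function leb01 (G n)" "\<And>n. square_integrable (G n)" "(\<lambda>n. abs_L2 (G n)) \<longlonglongrightarrow> g"
    using simple_approximation[OF g0(1)] unfolding g0(2) by blast
  define u where "u n = abs_L2 (F n)" for n
  define v where "v n = abs_L2 (G n)" for n
  have u: "u \<longlonglongrightarrow> f" and v: "v \<longlonglongrightarrow> g" using F(3) G(3) by (simp_all add: u_def[abs_def] v_def[abs_def])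
  define p where "p n = u n /\<^sub>R norm (u n)" for n
  define q' where "q' n = v n - inner (p n) (v n) *\<^sub>R p n" for n
  define q where "q n = q' n /\<^sub>R norm (q' n)" for n
  have "p \<longlonglongrightarrow> f /\<^sub>R norm f" unfolding p_def[abs_def] by (intro tendsto_intros u) (simp add: f)
  then have p: "p \<longlonglongrightarrow> f" by (simp add: f)
  have "q' \<longlonglongrightarrow> g - inner f g *\<^sub>R f" unfolding q'_def[abs_def] by (intro tendsto_intros v p)
  then have q': "q' \<longlonglongrightarrow> g" by (simp add: fg)
  have "q \<longlonglongrightarrow> g /\<^sub>R norm g" unfolding q_def[abs_def] by (intro tendsto_intros q') (simp add: g)
  then have q: "q \<longlonglongrightarrow> g" by (simp add: g)
  have nz: "\<forall>\<^sub>F n in sequentially. x n \<noteq> 0" if "x \<longlonglongrightarrow> h" "norm h = 1" for x :: "nat \<Rightarrow> L2" and h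
  proof -
    have "h \<noteq> 0" using that(2) by auto
    then show ?thesis using that(1) by (rule tendsto_imp_eventually_ne[rotated])
  qed
  have ev: "\<forall>\<^sub>F n in sequentially. inner (p n) (graphon_op K (p n)) + inner (q n) (graphon_op K (q n)) \<le> 8 / 7"
    using nz[OF u f] nz[OF q' g]
  proof eventually_elim
    case (elim n)
    define I where "I = F n ` {0..1} \<times> G n ` {0..1}"
    define A where "A = (\<lambda>p. {x \<in> {0..1}. F n x = fst p \<and> G n x = snd p})"
    note s = simple_in_steps[OF F(1)[of n] G(1)[of n] F(2)[of n] G(2)[of n], folded I_def A_def]
    note sub = subspace_steps[of I A]
    have ps: "p n \<in> steps I A" unfolding p_def u_def by (intro subspace_scale sub s)
    have qs: "q n \<in> steps I A" unfolding q_def q'_def v_def by (intro subspace_scale subspace_diff sub s ps)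
    have np: "norm (p n) = 1" using elim by (simp add: p_def)
    have nq: "norm (q n) = 1" using elim by (simp add: q_def)
    have "inner (p n) (p n) = 1" using np by (simp add: norm_eq_1)
    then have "inner (p n) (q' n) = 0" by (simp add: q'_def inner_diff_right)
    then have "inner (p n) (q n) = 0" by (simp add: q_def)
    then show ?case by (rule step_bound[OF K s(1) ps np qs nq])
  qed
  have "(\<lambda>n. inner (p n) (graphon_op K (p n)) + inner (q n) (graphon_op K (q n)))
      \<longlonglongrightarrow> inner f (graphon_op K f) + inner g (graphon_op K g)"
    by (intro tendsto_intros p q bounded_linear.tendsto[OF bounded_linear_graphon_op(1)[OF K]])
  then show ?thesis by (rule tendsto_upperbound[OF _ ev]) simp
qed

text \<open>
  The functional \<open>inner f\<close> has a nonzero kernel on a plane. This turns the min-max expression of the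
  second eigenvalue into a statement about orthonormal pairs.
\<close>

lemma unit_vector_in_plane:
  fixes f :: "'a :: real_inner"
  assumes U: "subspace U" "dim U = 2"
  obtains g where "g \<in> U" "norm g = 1" "inner f g = 0"
proof -
  obtain B where B: "B \<subseteq> U" "independent B" "U \<subseteq> span B" "card B = dim U"
    by (rule basis_exists)
  then obtain b1 b2 where b: "B = {b1, b2}" "b1 \<noteq> b2" using U(2) by (metis card_2_iff)
  define h where "h = (if inner f b1 = 0 then b1 else inner f b2 *\<^sub>R b1 - inner f b1 *\<^sub>R b2)"
  have hU: "h \<in> U" using B(1) U(1) by (auto simp: h_def b intro!: subspace_diff subspace_scale)
  have h0: "h \<noteq> 0"
  proof
    assume h: "h = 0"
    show False
    proof (cases "inner f b1 = 0")
      case True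
      then show False using h B(2) dependent_zero[of B] by (auto simp: h_def b)
    next
      case False
      then have "inner f b1 *\<^sub>R b2 = inner f b2 *\<^sub>R b1" using h by (simp add: h_def)
      then have "b2 = (inner f b2 / inner f b1) *\<^sub>R b1"
        using False by (metis divide_inverse mult.commute scaleR_scaleR scaleR_left_imp_eq right_inverse scaleR_one)
      then have "b2 \<in> span {b1}" by (metis span_base span_scale singletonI)
      moreover have "B - {b2} = {b1}" using b by auto
      ultimately show False using B(2) b unfolding dependent_def by auto
    qed
  qed
  have fh: "inner f h = 0" by (simp add: h_def inner_diff_right mult.commute)
  show thesis
  proof (rule that[of "h /\<^sub>R norm h"])
    show "h /\<^sub>R norm h \<in> U" by (intro subspace_scale U hU)
  qed (use h0 fh in auto)
qed

lemma L2_has_plane: obtains U :: "L2 set" where "subspace U" "dim U = 2"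
proof -
  define e1 e2 where "e1 = step_ind {0..1/2}" and "e2 = step_ind {1/2<..1}"
  have s: "{0..1/2::real} \<in> sets leb01" "{1/2<..1::real} \<in> sets leb01"
    by (auto simp: sets_restrict_space_iff)
  have m: "measure leb01 {0..1/2::real} = 1/2" "measure leb01 {1/2<..1::real} = 1/2"
    by (subst measure_restrict_space; auto)+
  have disj: "{0..1/2::real} \<inter> {1/2<..1} = {}" by auto
  have i: "inner e1 e1 = 1/2" "inner e2 e2 = 1/2" "inner e1 e2 = 0"
    unfolding e1_def e2_def by (simp_all add: inner_step_ind s m disj)
  have ne: "e1 \<noteq> e2" "e1 \<noteq> 0" "e2 \<noteq> 0" using i by auto
  have "independent {e1, e2}"
    by (rule pairwise_orthogonal_independent)
       (use i ne in \<open>auto simp: pairwise_def orthogonal_def inner_commute\<close>)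
  then have "dim (span {e1, e2}) = 2" using ne by (simp add: dim_eq_card_independent)
  then show thesis using that[of "span {e1, e2}"] by simp
qed

theorem theorem3p5:
  fixes K :: "real \<times> real \<Rightarrow> real"
  assumes "graphon K"
  shows "spectral_sum K \<le> 8 / 7"
proof -
  define q where "q h = inner h (graphon_op K h)" for h
  have q_abs: "\<bar>q h\<bar> \<le> 1" if "norm h = 1" for h
    using Cauchy_Schwarz_ineq2[of h "graphon_op K h"] bounded_linear_graphon_op(2)[OF assms, of h] that
    by (simp add: q_def)
  obtain U0 :: "L2 set" where U0: "subspace U0" "dim U0 = 2" by (rule L2_has_plane)
  obtain h0 :: L2 where h0: "norm h0 = 1" using unit_vector_in_plane[OF U0] by metis
  have "mu2 K \<le> 8 / 7 - q f" if f: "norm f = 1" for f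
    unfolding mu2_def q_def[symmetric]
  proof (rule cSUP_least)
    show "{U :: L2 set. subspace U \<and> dim U = 2} \<noteq> {}" using U0 by blast
    fix U :: "L2 set" assume "U \<in> {U. subspace U \<and> dim U = 2}"
    then obtain g where g: "g \<in> U" "norm g = 1" "inner f g = 0"
      using unit_vector_in_plane[of U f] by blast
    have "bdd_below (q ` {h \<in> U. norm h = 1})"
    proof (rule bdd_belowI2)
      show "- 1 \<le> q h" if "h \<in> {h \<in> U. norm h = 1}" for h using q_abs[of h] that by simp
    qed
    then have "(INF h\<in>{h \<in> U. norm h = 1}. q h) \<le> q g" using g by (intro cINF_lower) auto
    also have "\<dots> \<le> 8 / 7 - q f"
      using orthonormal_pair_bound[OF assms f g(2,3)] by (simp add: q_def)
    finally show "(INF h\<in>{h \<in> U. norm h = 1}. q h) \<le> 8 / 7 - q f" .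
  qed
  then have "q f \<le> 8 / 7 - mu2 K" if "norm f = 1" for f using that by fastforce
  then have "mu1 K \<le> 8 / 7 - mu2 K"
    unfolding mu1_def q_def[symmetric] using h0 by (intro cSUP_least) auto
  then show ?thesis by (simp add: spectral_sum_def)
qed

end
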